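(* Let $n\ge1$ and $m\ge0$ be integers, and let $H_{n,m}$, $\langle-,-\rangle$ and $L$ be as defined in the context. Then: (a) (Poincaré duality) The bilinear pairing $\langle-,-\rangle:H_{n,m}\times H_{n,m}\to\mathbb{R}$ is an $S_n$-equivariant symmetric graded bilinear form, which is non-degenerate. (b) (Hard Lefschetz) $L:H_{n,m}^{i}\to H_{n,m}^{i+2}$ is an $S_n$-equivariant Lefschetz operator satisfying the hard Lefschetz theorem, i.e., for all $i\ge0$, $L^i:H_{n,m}^{-i}\to H_{n,m}^{i}$ is an isomorphism. (c) (Hodge--Riemann relations) For all integers $0\le i\le m/2$, the bilinear form $(a,b)_L^{-m+2i}=\langle a,L^{m-2i}b\rangle$ on $H_{n,m}^{-m+2i}$ is $S_n$-equivariant and is $(-1)^i$-definite on the primitive subspace $P_L^{-m+2i}=\ker(L^{m-2i+1})\cap H_{n,m}^{-m+2i}$.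
   Context: Let $D=\mathbb{R}[d_1,\dots,d_n]$ and $R=\mathbb{R}[x_1,\dots,x_n]$ be polynomial rings with all variables of degree $1$, with homogeneous pieces $D^i$, $R^j$. Put $H_{n,m}=\bigoplus_{i=0}^m H_{n,m}^{-m+2i}$ with $H_{n,m}^{-m+2i}:=D^i\otimes R^{m-i}$ (all other graded pieces are $0$). The symmetric group $S_n$ acts on $D$ and $R$ by permuting the indices of the variables, hence diagonally on $H_{n,m}$. The pairing is the bilinear extension of $\langle d\otimes f,d'\otimes f'\rangle:=(d,f')(d',f)$, where $(d,f)=(d\cdot f)(0)$ is obtained by letting $d$ act on $f$ as a differential operator with $d_k$ acting as $\partial/\partial x_k$, and evaluating at $x=0$. The operator is $L:=\sum_{k=1}^n d_k\otimes\frac{\partial}{\partial x_k}$, where $d_k$ acts by multiplication on $D$. A bilinear form on a graded space $H$ is graded if $\langle H^i,H^j\rangle=0$ whenever $i\ne -j$. A degree-two linear map $L$ is a Lefschetz operator if $\langle La,b\rangle=\langle a,Lb\rangle$ for all $a,b\in H$. A bilinear form is $S_n$-equivariant if $\langle\sigma a,\sigma b\rangle=\langle a,b\rangle$ for all $\sigma\in S_n$; an operator is $S_n$-equivariant if it commutes with $S_n$. A symmetric bilinear form is $(-1)^i$-definite if $(-1)^i$ times it is positive definite (vacuously true on the zero space). *)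

theory Defs
  imports "HOL-Analysis.Analysis" "HOL-Library.Poly_Mapping"
begin

section \<open>Finitely supported functions as real vector spaces\<close>

abbreviation "lookup \<equiv> Poly_Mapping.lookup"
abbreviation "keys \<equiv> Poly_Mapping.keys"

instantiation poly_mapping :: (type, real_vector) real_vector
begin

lift_definition scaleR_poly_mapping :: "real \<Rightarrow> ('a \<Rightarrow>\<^sub>0 'b) \<Rightarrow> 'a \<Rightarrow>\<^sub>0 'b"
  is "\<lambda>c f k. c *\<^sub>R f k"
  by (rule rev_finite_subset) auto

instance
  by standard (transfer; simp add: fun_eq_iff scaleR_add_right scaleR_add_left)+

end

lemma lookup_scaleR [simp]: "lookup (c *\<^sub>R p) k = c *\<^sub>R lookup p k"
  by transfer simp

lemma poly_mapping_expand:
  fixes p :: "'a \<Rightarrow>\<^sub>0 real"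
  shows "p = (\<Sum>a\<in>keys p. lookup p a *\<^sub>R Poly_Mapping.single a 1)"
proof (rule poly_mapping_eqI)
  fix k
  have "(\<Sum>a\<in>keys p. lookup p a * lookup (Poly_Mapping.single a (1::real)) k)
      = (\<Sum>a\<in>keys p. if a = k then lookup p k else 0)"
    by (intro sum.cong) (auto simp: lookup_single)
  also have "\<dots> = lookup p k"
    by (auto simp: sum.delta in_keys_iff)
  finally show "lookup p k = lookup (\<Sum>a\<in>keys p. lookup p a *\<^sub>R Poly_Mapping.single a 1) k"
    by (simp add: lookup_sum)
qed

definition lin_ext :: "('a \<Rightarrow> 'v) \<Rightarrow> ('a \<Rightarrow>\<^sub>0 real) \<Rightarrow> 'v::real_vector" where
  "lin_ext g p = (\<Sum>a\<in>keys p. lookup p a *\<^sub>R g a)"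

lemma lin_ext_superset:
  assumes "finite A" "keys p \<subseteq> A"
  shows "lin_ext g p = (\<Sum>a\<in>A. lookup p a *\<^sub>R g a)"
  unfolding lin_ext_def using assms
  by (intro sum.mono_neutral_left) (auto simp: in_keys_iff)

lemma linear_lin_ext: "linear (lin_ext g)"
proof (rule linearI)
  fix p q :: "'a \<Rightarrow>\<^sub>0 real" and c :: real
  show "lin_ext g (p + q) = lin_ext g p + lin_ext g q"
  proof -
    let ?A = "keys p \<union> keys q"
    have "lin_ext g (p + q) = (\<Sum>a\<in>?A. lookup (p + q) a *\<^sub>R g a)"
      by (rule lin_ext_superset) (use keys_add[of p q] in auto)
    also have "\<dots> = (\<Sum>a\<in>?A. lookup p a *\<^sub>R g a) + (\<Sum>a\<in>?A. lookup q a *\<^sub>R g a)"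
      by (simp add: lookup_add scaleR_add_left sum.distrib)
    also have "\<dots> = lin_ext g p + lin_ext g q"
      by (simp add: lin_ext_superset[of ?A])
    finally show ?thesis .
  qed
  have "lin_ext g (c *\<^sub>R p) = (\<Sum>a\<in>keys p. lookup (c *\<^sub>R p) a *\<^sub>R g a)"
    by (rule lin_ext_superset) (auto simp: in_keys_iff)
  then show "lin_ext g (c *\<^sub>R p) = c *\<^sub>R lin_ext g p"
    by (simp add: lin_ext_def scaleR_sum_right)
qed

lemma lin_ext_single [simp]: "lin_ext g (Poly_Mapping.single a c) = c *\<^sub>R g a"
  by (simp add: lin_ext_def)

lemma linear_eq_on_monomials:
  fixes f g :: "('a \<Rightarrow>\<^sub>0 real) \<Rightarrow> 'v::real_vector"
  assumes "linear f" "linear g"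
    and "\<And>a. f (Poly_Mapping.single a 1) = g (Poly_Mapping.single a 1)"
  shows "f p = g p"
  by (subst (1 2) poly_mapping_expand[of p])
     (simp add: linear_sum[OF assms(1)] linear_sum[OF assms(2)]
        linear_scale[OF assms(1)] linear_scale[OF assms(2)] assms(3))


section \<open>Real polynomials in variables indexed by a finite type\<close>

text \<open>
  The number of variables \<open>n\<close> is \<open>CARD('n)\<close>. The type \<open>'n rpoly\<close> serves both for \<open>D\<close>
  (variables \<open>d\<^sub>k\<close>) and for \<open>R\<close> (variables \<open>x\<^sub>k\<close>).
\<close>

type_synonym 'n mono = "'n \<Rightarrow>\<^sub>0 nat"
type_synonym 'n rpoly = "'n mono \<Rightarrow>\<^sub>0 real"

definition rmonom :: "'n mono \<Rightarrow> 'n rpoly" where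
  "rmonom a = Poly_Mapping.single a 1"

definition pvar :: "'n \<Rightarrow> 'n rpoly" where
  "pvar k = rmonom (Poly_Mapping.single k 1)"

definition mdeg :: "'n::finite mono \<Rightarrow> nat" where
  "mdeg a = (\<Sum>k\<in>UNIV. lookup a k)"

definition homog :: "nat \<Rightarrow> 'n::finite rpoly set" where
  "homog i = {p. \<forall>a\<in>keys p. mdeg a = i}"

definition peval :: "('n::finite \<Rightarrow> real) \<Rightarrow> 'n rpoly \<Rightarrow> real" where
  "peval v = lin_ext (\<lambda>a. \<Prod>k\<in>UNIV. v k ^ lookup a k)"

text \<open>
  The coefficient vanishes when \<open>x\<^sub>k\<close> does not occur, so the truncated exponent is harmless.
\<close>

definition pdiff :: "'n \<Rightarrow> 'n rpoly \<Rightarrow> 'n rpoly" where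
  "pdiff k = lin_ext (\<lambda>a. real (lookup a k) *\<^sub>R rmonom (a - Poly_Mapping.single k 1))"

text \<open>
  \<open>mono_diff a\<close> composes the commuting operators \<open>(\<partial>/\<partial>x\<^sub>k)\<^bsup>a\<^sub>k\<^esup>\<close> over all \<open>k\<close>;
  \<open>diff_op d\<close> is the differential operator obtained from \<open>d\<close> by \<open>d\<^sub>k \<mapsto> \<partial>/\<partial>x\<^sub>k\<close>.
\<close>

definition mono_diff :: "'n::finite mono \<Rightarrow> 'n rpoly \<Rightarrow> 'n rpoly" where
  "mono_diff a f = Finite_Set.fold (\<lambda>k. pdiff k ^^ lookup a k) f UNIV"

definition diff_op :: "'n::finite rpoly \<Rightarrow> 'n rpoly \<Rightarrow> 'n rpoly" where
  "diff_op d f = lin_ext (\<lambda>a. mono_diff a f) d"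

definition dpair :: "'n::finite rpoly \<Rightarrow> 'n rpoly \<Rightarrow> real" where
  "dpair d f = peval (\<lambda>_. 0) (diff_op d f)"

text \<open>The ring endomorphism sending the variable with index \<open>k\<close> to the one with index \<open>\<sigma> k\<close>.\<close>

definition permute_vars :: "('n \<Rightarrow> 'n) \<Rightarrow> 'n::finite rpoly \<Rightarrow> 'n rpoly" where
  "permute_vars \<sigma> = lin_ext (\<lambda>a. \<Prod>k\<in>UNIV. pvar (\<sigma> k) ^ lookup a k)"


section \<open>The tensor product of the two polynomial rings\<close>

text \<open>
  Since \<open>D\<close> and \<open>R\<close> are free on their monomials, \<open>D \<otimes> R\<close> is the free space on pairs of
  monomials; \<open>tensor_lift_unique\<close> below is its universal property.
\<close>

type_synonym 'n tens = "('n mono \<times> 'n mono) \<Rightarrow>\<^sub>0 real"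

definition tensor :: "'n rpoly \<Rightarrow> 'n rpoly \<Rightarrow> 'n tens" (infix \<open>\<otimes>\<close> 75) where
  "d \<otimes> f = lin_ext (\<lambda>a. lin_ext (\<lambda>b. Poly_Mapping.single (a, b) 1) f) d"

definition tensor_lift :: "('n rpoly \<Rightarrow> 'n rpoly \<Rightarrow> 'v::real_vector) \<Rightarrow> 'n tens \<Rightarrow> 'v" where
  "tensor_lift B = lin_ext (\<lambda>(a, b). B (rmonom a) (rmonom b))"

definition H_piece :: "nat \<Rightarrow> int \<Rightarrow> 'n::finite tens set" where
  "H_piece m j = span {d \<otimes> f | d f i. i \<le> m \<and> j = - int m + 2 * int i
                                     \<and> d \<in> homog i \<and> f \<in> homog (m - i)}"

definition tens_act :: "('n \<Rightarrow> 'n) \<Rightarrow> 'n::finite tens \<Rightarrow> 'n tens" where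
  "tens_act \<sigma> = tensor_lift (\<lambda>d f. permute_vars \<sigma> d \<otimes> permute_vars \<sigma> f)"

definition pairing :: "'n::finite tens \<Rightarrow> 'n tens \<Rightarrow> real" where
  "pairing s t =
     tensor_lift (\<lambda>d f. tensor_lift (\<lambda>d' f'. dpair d f' * dpair d' f) t) s"

definition Lop :: "'n::finite tens \<Rightarrow> 'n tens" where
  "Lop = tensor_lift (\<lambda>d f. \<Sum>k\<in>UNIV. (pvar k * d) \<otimes> pdiff k f)"


section \<open>Graded spaces with forms and operators\<close>

text \<open>
  A graded space is given by its pieces \<open>V :: int \<Rightarrow> 'v set\<close>, subspaces of an ambient vector space.
\<close>

definition gr_total :: "(int \<Rightarrow> 'v::real_vector set) \<Rightarrow> 'v set" where
  "gr_total V = span (\<Union>j. V j)"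

definition graded_form :: "(int \<Rightarrow> 'v set) \<Rightarrow> ('v \<Rightarrow> 'v \<Rightarrow> real) \<Rightarrow> bool" where
  "graded_form V B \<longleftrightarrow> (\<forall>i j. i \<noteq> - j \<longrightarrow> (\<forall>a\<in>V i. \<forall>b\<in>V j. B a b = 0))"

definition symmetric_form_on :: "'v set \<Rightarrow> ('v \<Rightarrow> 'v \<Rightarrow> real) \<Rightarrow> bool" where
  "symmetric_form_on W B \<longleftrightarrow> (\<forall>a\<in>W. \<forall>b\<in>W. B a b = B b a)"

definition nondegenerate_on :: "'v::zero set \<Rightarrow> ('v \<Rightarrow> 'v \<Rightarrow> real) \<Rightarrow> bool" where
  "nondegenerate_on W B \<longleftrightarrow>
     (\<forall>a\<in>W. (\<forall>b\<in>W. B a b = 0) \<longrightarrow> a = 0) \<and> (\<forall>b\<in>W. (\<forall>a\<in>W. B a b = 0) \<longrightarrow> b = 0)"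

definition pos_definite_on :: "'v::zero set \<Rightarrow> ('v \<Rightarrow> 'v \<Rightarrow> real) \<Rightarrow> bool" where
  "pos_definite_on W B \<longleftrightarrow> (\<forall>a\<in>W. a \<noteq> 0 \<longrightarrow> B a a > 0)"

text \<open>The symmetric group of the index set consists of its bijections.\<close>

definition equivariant_form_on ::
  "(('n \<Rightarrow> 'n) \<Rightarrow> 'v \<Rightarrow> 'v) \<Rightarrow> 'v set \<Rightarrow> ('v \<Rightarrow> 'v \<Rightarrow> real) \<Rightarrow> bool" where
  "equivariant_form_on act W B \<longleftrightarrow>
     (\<forall>\<sigma>. bij \<sigma> \<longrightarrow> (\<forall>a\<in>W. \<forall>b\<in>W. B (act \<sigma> a) (act \<sigma> b) = B a b))"

definition equivariant_op_on ::
  "(('n \<Rightarrow> 'n) \<Rightarrow> 'v \<Rightarrow> 'v) \<Rightarrow> 'v set \<Rightarrow> ('v \<Rightarrow> 'v) \<Rightarrow> bool" where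
  "equivariant_op_on act W F \<longleftrightarrow> (\<forall>\<sigma>. bij \<sigma> \<longrightarrow> (\<forall>a\<in>W. F (act \<sigma> a) = act \<sigma> (F a)))"

definition lefschetz_operator ::
  "(int \<Rightarrow> 'v::real_vector set) \<Rightarrow> ('v \<Rightarrow> 'v \<Rightarrow> real) \<Rightarrow> ('v \<Rightarrow> 'v) \<Rightarrow> bool" where
  "lefschetz_operator V B F \<longleftrightarrow>
     linear F \<and> (\<forall>j. F ` V j \<subseteq> V (j + 2)) \<and>
     (\<forall>a\<in>gr_total V. \<forall>b\<in>gr_total V. B (F a) b = B a (F b))"

text \<open>For linear \<open>F\<close> the powers are linear, so a bijection is an isomorphism.\<close>

definition hard_lefschetz :: "(int \<Rightarrow> 'v set) \<Rightarrow> ('v \<Rightarrow> 'v) \<Rightarrow> bool" where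
  "hard_lefschetz V F \<longleftrightarrow> (\<forall>i::nat. bij_betw (F ^^ i) (V (- int i)) (V (int i)))"

text \<open>The form and the primitive subspace in degree \<open>- r\<close>.\<close>

definition lefschetz_form ::
  "('v \<Rightarrow> 'v \<Rightarrow> real) \<Rightarrow> ('v \<Rightarrow> 'v) \<Rightarrow> nat \<Rightarrow> 'v \<Rightarrow> 'v \<Rightarrow> real" where
  "lefschetz_form B F r a b = B a ((F ^^ r) b)"

definition primitive :: "(int \<Rightarrow> 'v::zero set) \<Rightarrow> ('v \<Rightarrow> 'v) \<Rightarrow> nat \<Rightarrow> 'v set" where
  "primitive V F r = {a \<in> V (- int r). (F ^^ (r + 1)) a = 0}"


section \<open>Consistency of the definitions\<close>

lemma bilinear_tensor: "bilinear ((\<otimes>) :: 'n rpoly \<Rightarrow> 'n rpoly \<Rightarrow> 'n tens)"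
proof -
  have 1: "linear (\<lambda>f. d \<otimes> f)" for d :: "'n rpoly"
    unfolding tensor_def lin_ext_def[of _ d]
    by (intro linear_compose_sum linear_compose_scale_right ballI linear_lin_ext)
  have 2: "linear (\<lambda>d. d \<otimes> f)" for f :: "'n rpoly"
    unfolding tensor_def by (rule linear_lin_ext)
  show ?thesis using 1 2 by (simp add: bilinear_def)
qed

lemma linear_tensor_lift: "linear (tensor_lift B)"
  unfolding tensor_lift_def by (rule linear_lin_ext)

lemma tensor_lift_sum:
  "tensor_lift B t = (\<Sum>c\<in>keys t. lookup t c *\<^sub>R B (rmonom (fst c)) (rmonom (snd c)))"
  by (simp add: tensor_lift_def lin_ext_def case_prod_beta)

lemma tensor_rmonom: "rmonom a \<otimes> rmonom b = Poly_Mapping.single (a, b) 1"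
  by (simp add: tensor_def rmonom_def)

lemma bilinear_eq_on_monomials:
  fixes B C :: "'n rpoly \<Rightarrow> 'n rpoly \<Rightarrow> 'v::real_vector"
  assumes "bilinear B" "bilinear C" "\<And>a b. B (rmonom a) (rmonom b) = C (rmonom a) (rmonom b)"
  shows "B d f = C d f"
proof -
  have "B (rmonom a) f = C (rmonom a) f" for a
    using assms unfolding bilinear_def rmonom_def
    by (intro linear_eq_on_monomials[of "B (Poly_Mapping.single a 1)" "C (Poly_Mapping.single a 1)" f]) auto
  then show ?thesis
    using assms unfolding bilinear_def rmonom_def
    by (intro linear_eq_on_monomials[of "\<lambda>d. B d f" "\<lambda>d. C d f" d]) auto
qed

lemma tensor_lift_tensor:
  assumes "bilinear B"
  shows "tensor_lift B (d \<otimes> f) = B d f"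
proof (rule bilinear_eq_on_monomials[of "\<lambda>d f. tensor_lift B (d \<otimes> f)" B])
  show "bilinear (\<lambda>d f. tensor_lift B (d \<otimes> f))"
    using bilinear_tensor linear_tensor_lift[of B]
    unfolding bilinear_def by (auto intro: linear_compose[unfolded o_def])
qed (use assms in \<open>auto simp: tensor_rmonom tensor_lift_def\<close>)

lemma tensor_lift_unique:
  assumes "linear F" "\<And>d f. F (d \<otimes> f) = B d f"
  shows "F = tensor_lift B"
proof
  fix t
  show "F t = tensor_lift B t"
  proof (rule linear_eq_on_monomials[OF assms(1) linear_tensor_lift])
    fix c :: "'a mono \<times> 'a mono"
    show "F (Poly_Mapping.single c 1) = tensor_lift B (Poly_Mapping.single c 1)"
      using assms(2)[of "rmonom (fst c)" "rmonom (snd c)"]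
      by (cases c) (simp add: tensor_rmonom tensor_lift_def)
  qed
qed

lemma linear_pdiff: "linear (pdiff k)"
  unfolding pdiff_def by (rule linear_lin_ext)

lemma pdiff_rmonom:
  "pdiff k (rmonom a) = real (lookup a k) *\<^sub>R rmonom (a - Poly_Mapping.single k 1)"
  by (simp add: pdiff_def rmonom_def)

lemma rmonom_mult: "rmonom a * rmonom b = rmonom (a + b)"
  by (simp add: rmonom_def mult_single)

lemma rmonom_0: "rmonom 0 = 1"
  by (simp add: rmonom_def)

lemma rpoly_mult_scaleR:
  fixes p q :: "'n rpoly"
  shows "(c *\<^sub>R p) * q = c *\<^sub>R (p * q)" "p * (c *\<^sub>R q) = c *\<^sub>R (p * q)"
proof -
  have *: "c *\<^sub>R p = Poly_Mapping.single 0 c * p" for p :: "'n rpoly"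
    by (rule poly_mapping_eqI)
       (simp add: mult_map_scale_conv_mult[symmetric] Poly_Mapping.map.rep_eq when_def)
  show "(c *\<^sub>R p) * q = c *\<^sub>R (p * q)" "p * (c *\<^sub>R q) = c *\<^sub>R (p * q)"
    unfolding * by (simp_all add: algebra_simps)
qed

lemma bilinear_mult: "bilinear ((*) :: 'n rpoly \<Rightarrow> 'n rpoly \<Rightarrow> 'n rpoly)"
  unfolding bilinear_def by (auto intro!: linearI simp: algebra_simps rpoly_mult_scaleR)

lemma pdiff_mult: "pdiff k (p * q) = pdiff k p * q + p * pdiff k q"
proof (rule bilinear_eq_on_monomials
    [of "\<lambda>p q. pdiff k (p * q)" "\<lambda>p q. pdiff k p * q + p * pdiff k q"])
  show "bilinear (\<lambda>p q. pdiff k (p * q))"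
    "bilinear (\<lambda>p q. pdiff k p * q + p * pdiff k q)"
    using linear_pdiff[of k] unfolding bilinear_def
    by (auto intro!: linearI simp: algebra_simps rpoly_mult_scaleR linear_add linear_scale)
next
  fix a b :: "'a mono"
  let ?e = "Poly_Mapping.single k (1::nat)"
  have l: "real (lookup a k) *\<^sub>R rmonom (a - ?e + b) = real (lookup a k) *\<^sub>R rmonom (a + b - ?e)"
    for a b :: "'a mono"
  proof (cases "lookup a k = 0")
    case False
    then have "a - ?e + b = a + b - ?e"
      by (intro poly_mapping_eqI) (auto simp: lookup_add lookup_minus lookup_single when_def)
    then show ?thesis by simp
  qed simp
  show "pdiff k (rmonom a * rmonom b) = pdiff k (rmonom a) * rmonom b + rmonom a * pdiff k (rmonom b)"
    by (simp only: pdiff_rmonom rmonom_mult rpoly_mult_scaleR lookup_add of_nat_add scaleR_add_left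
        add.commute[of a "b - ?e"] l add.commute[of b a])
qed

lemma pdiff_pvar: "pdiff k (pvar j) = (if j = k then 1 else 0)"
  by (simp add: pvar_def pdiff_rmonom lookup_single rmonom_0)

lemma pdiff_commute: "pdiff j (pdiff k p) = pdiff k (pdiff j p)"
proof (rule linear_eq_on_monomials[of "\<lambda>p. pdiff j (pdiff k p)" "\<lambda>p. pdiff k (pdiff j p)"])
  show "linear (\<lambda>p. pdiff j (pdiff k p))" "linear (\<lambda>p. pdiff k (pdiff j p))"
    using linear_compose[OF linear_pdiff linear_pdiff] by (simp_all add: o_def)
  fix a :: "'a mono"
  have "a - Poly_Mapping.single k 1 - Poly_Mapping.single j 1
      = a - Poly_Mapping.single j 1 - Poly_Mapping.single k (1::nat)"
    by (intro poly_mapping_eqI) (simp add: lookup_minus)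
  then show "pdiff j (pdiff k (Poly_Mapping.single a 1)) = pdiff k (pdiff j (Poly_Mapping.single a 1))"
    unfolding rmonom_def[symmetric]
    by (cases "j = k")
       (simp_all add: pdiff_rmonom linear_scale[OF linear_pdiff] lookup_minus lookup_single)
qed

lemma pdiff_funpow_commute: "(pdiff j ^^ r) ((pdiff k ^^ s) p) = (pdiff k ^^ s) ((pdiff j ^^ r) p)"
proof -
  have 1: "pdiff j ((pdiff k ^^ s) p) = (pdiff k ^^ s) (pdiff j p)" for p
    by (induction s) (auto simp: pdiff_commute[of j k])
  show ?thesis
    by (induction r) (auto simp: 1)
qed

lemma comp_fun_commute_mono_diff: "comp_fun_commute_on UNIV (\<lambda>k. pdiff k ^^ lookup a k)"
  by unfold_locales (auto simp: fun_eq_iff pdiff_funpow_commute)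

lemma mono_diff_add: "mono_diff (a + b) f = mono_diff a (mono_diff b f)"
proof -
  have comm: "(pdiff k ^^ r) (Finite_Set.fold (\<lambda>k. pdiff k ^^ lookup a k) f A)
      = Finite_Set.fold (\<lambda>k. pdiff k ^^ lookup a k) ((pdiff k ^^ r) f) A"
    if "finite A" for A k r f and a :: "'a mono"
  proof -
    interpret comp_fun_commute_on UNIV "\<lambda>k. pdiff k ^^ lookup a k"
      by (rule comp_fun_commute_mono_diff)
    show ?thesis using that
    proof (induction A)
      case (insert x A)
      then show ?case
        using pdiff_funpow_commute[of r k "lookup a x" x] by simp
    qed simp
  qed
  have "Finite_Set.fold (\<lambda>k. pdiff k ^^ lookup (a + b) k) f A
      = Finite_Set.fold (\<lambda>k. pdiff k ^^ lookup a k)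
          (Finite_Set.fold (\<lambda>k. pdiff k ^^ lookup b k) f A) A"
    if "finite A" for A
  proof -
    interpret ab: comp_fun_commute_on UNIV "\<lambda>k. pdiff k ^^ lookup (a + b) k"
      by (rule comp_fun_commute_mono_diff)
    interpret a: comp_fun_commute_on UNIV "\<lambda>k. pdiff k ^^ lookup a k"
      by (rule comp_fun_commute_mono_diff)
    interpret b: comp_fun_commute_on UNIV "\<lambda>k. pdiff k ^^ lookup b k"
      by (rule comp_fun_commute_mono_diff)
    show ?thesis using that
    proof (induction A)
      case (insert x A)
      show ?case
        unfolding ab.fold_insert[OF subset_UNIV insert.hyps] a.fold_insert[OF subset_UNIV insert.hyps]
          b.fold_insert[OF subset_UNIV insert.hyps] insert.IH comm[OF insert.hyps(1), symmetric]
        by (simp add: lookup_add funpow_add)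
    qed simp
  qed
  then show ?thesis by (simp add: mono_diff_def)
qed

lemma mono_diff_single: "mono_diff (Poly_Mapping.single k r) f = (pdiff k ^^ r) f"
proof -
  let ?a = "Poly_Mapping.single k r"
  interpret comp_fun_commute_on UNIV "\<lambda>k. pdiff k ^^ lookup ?a k"
    by (rule comp_fun_commute_mono_diff)
  have "Finite_Set.fold (\<lambda>k. pdiff k ^^ lookup ?a k) f A = (if k \<in> A then (pdiff k ^^ r) f else f)"
    if "finite A" for A
    using that
  proof (induction A)
    case (insert x A)
    have "Finite_Set.fold (\<lambda>k. pdiff k ^^ lookup ?a k) f (insert x A)
        = (pdiff x ^^ lookup ?a x) (if k \<in> A then (pdiff k ^^ r) f else f)"
      unfolding fold_insert[OF subset_UNIV insert.hyps] insert.IH ..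
    with insert.hyps show ?case
      by (auto simp: lookup_single when_def)
  qed simp
  then show ?thesis by (simp add: mono_diff_def)
qed

lemma mono_diff_0: "mono_diff 0 f = f"
  using mono_diff_single[of undefined 0 f] by simp

lemma linear_mono_diff: "linear (mono_diff a)"
proof -
  interpret comp_fun_commute_on UNIV "\<lambda>k. pdiff k ^^ lookup a k"
    by (rule comp_fun_commute_mono_diff)
  have p: "linear (pdiff k ^^ r)" for k :: 'a and r
  proof (induction r)
    case (Suc r)
    then show ?case unfolding funpow.simps by (rule linear_compose) (rule linear_pdiff)
  qed (simp add: linear_id[unfolded id_def] id_def)
  have "linear (\<lambda>f. Finite_Set.fold (\<lambda>k. pdiff k ^^ lookup a k) f A)" if "finite A" for A
    using that
  proof (induction A)
    case (insert x A)
    then show ?case using linear_compose[OF insert.IH p[of "lookup a x" x]] by (simp add: o_def)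
  qed (auto intro: linear_id[unfolded id_def])
  from this[of UNIV] show ?thesis by (simp add: mono_diff_def[abs_def])
qed

lemma bilinear_diff_op: "bilinear diff_op"
proof -
  have "linear (diff_op d)" for d :: "'a rpoly"
    unfolding diff_op_def lin_ext_def
    by (intro linear_compose_sum linear_compose_scale_right ballI linear_mono_diff)
  moreover have "linear (\<lambda>d. diff_op d f)" for f :: "'a rpoly"
    unfolding diff_op_def by (rule linear_lin_ext)
  ultimately show ?thesis by (simp add: bilinear_def)
qed

lemma diff_op_1: "diff_op 1 f = f"
  using lin_ext_single[of "\<lambda>a. mono_diff a f" 0 1]
  by (simp add: diff_op_def mono_diff_0)

lemma diff_op_pvar: "diff_op (pvar k) f = pdiff k f"
  by (simp add: diff_op_def pvar_def rmonom_def mono_diff_single)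

lemma diff_op_mult: "diff_op (d * e) f = diff_op d (diff_op e f)"
proof (rule bilinear_eq_on_monomials
    [of "\<lambda>d e. diff_op (d * e) f" "\<lambda>d e. diff_op d (diff_op e f)"])
  show "bilinear (\<lambda>d e. diff_op (d * e) f)" "bilinear (\<lambda>d e. diff_op d (diff_op e f))"
    unfolding bilinear_def
    by (auto intro!: linearI simp: algebra_simps rpoly_mult_scaleR bilinear_ladd[OF bilinear_diff_op]
        bilinear_radd[OF bilinear_diff_op] bilinear_lmul[OF bilinear_diff_op]
        bilinear_rmul[OF bilinear_diff_op])
  fix a b :: "'a mono"
  show "diff_op (rmonom a * rmonom b) f = diff_op (rmonom a) (diff_op (rmonom b) f)"
    unfolding rmonom_mult by (simp add: diff_op_def rmonom_def mono_diff_add)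
qed

lemma linear_peval: "linear (peval v)"
  unfolding peval_def by (rule linear_lin_ext)

lemma bilinear_dpair: "bilinear dpair"
  using linear_peval[of "\<lambda>_. 0"] bilinear_diff_op
  unfolding bilinear_def dpair_def by (auto intro: linear_compose[unfolded o_def])

lemma pairing_tensor:
  "pairing (d \<otimes> f) (d' \<otimes> f') = dpair d f' * dpair d' f"
proof -
  note s = bilinear_ladd[OF bilinear_dpair] bilinear_radd[OF bilinear_dpair]
    bilinear_lmul[OF bilinear_dpair] bilinear_rmul[OF bilinear_dpair]
  have 1: "bilinear (\<lambda>d' f'. dpair d f' * dpair d' f)" for d f :: "'a rpoly"
    unfolding bilinear_def by (auto intro!: linearI simp: s algebra_simps)
  have 2: "bilinear (\<lambda>d f. tensor_lift (\<lambda>d' f'. dpair d f' * dpair d' f) (d' \<otimes> f'))"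
    unfolding tensor_lift_tensor[OF 1] bilinear_def
    by (auto intro!: linearI simp: s algebra_simps)
  show ?thesis
    using tensor_lift_tensor[OF 2, of d f] by (simp add: pairing_def tensor_lift_tensor[OF 1])
qed

lemma bilinear_pairing: "bilinear pairing"
  unfolding bilinear_def
proof (intro conjI allI)
  fix s t :: "'a tens"
  show "linear (pairing s)"
    unfolding pairing_def tensor_lift_sum[of _ s]
    by (intro linear_compose_sum linear_compose_scale_right ballI linear_tensor_lift)
  show "linear (\<lambda>s. pairing s t)"
    unfolding pairing_def by (rule linear_tensor_lift)
qed

lemma Lop_tensor: "Lop (d \<otimes> f) = (\<Sum>k\<in>UNIV. (pvar k * d) \<otimes> pdiff k f)"
proof -
  have "bilinear (\<lambda>d f. \<Sum>k\<in>UNIV. (pvar k * d) \<otimes> pdiff k f :: 'a tens)"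
    unfolding bilinear_def
    by (auto intro!: linearI simp: algebra_simps rpoly_mult_scaleR sum.distrib scaleR_sum_right
      bilinear_ladd[OF bilinear_tensor] bilinear_radd[OF bilinear_tensor]
      bilinear_lmul[OF bilinear_tensor] bilinear_rmul[OF bilinear_tensor]
      linear_add[OF linear_pdiff] linear_scale[OF linear_pdiff])
  then show ?thesis unfolding Lop_def by (rule tensor_lift_tensor)
qed

lemma linear_permute_vars: "linear (permute_vars \<sigma>)"
  unfolding permute_vars_def by (rule linear_lin_ext)

lemma permute_vars_pvar: "permute_vars \<sigma> (pvar k) = pvar (\<sigma> k)"
proof -
  have "(\<Prod>j\<in>UNIV. pvar (\<sigma> j) ^ lookup (Poly_Mapping.single k (1::nat)) j)
      = (\<Prod>j\<in>UNIV. if j = k then pvar (\<sigma> k) else 1)"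
    by (intro prod.cong) (auto simp: lookup_single)
  then show ?thesis by (simp add: permute_vars_def pvar_def[of k] rmonom_def)
qed

lemma permute_vars_1: "permute_vars \<sigma> 1 = 1"
  using lin_ext_single[of "\<lambda>a. \<Prod>k\<in>UNIV. pvar (\<sigma> k) ^ lookup a k" 0 1]
  by (simp add: permute_vars_def)

lemma permute_vars_mult: "permute_vars \<sigma> (p * q) = permute_vars \<sigma> p * permute_vars \<sigma> q"
proof (rule bilinear_eq_on_monomials
    [of "\<lambda>p q. permute_vars \<sigma> (p * q)" "\<lambda>p q. permute_vars \<sigma> p * permute_vars \<sigma> q"])
  show "bilinear (\<lambda>p q. permute_vars \<sigma> (p * q))"
    "bilinear (\<lambda>p q. permute_vars \<sigma> p * permute_vars \<sigma> q)"
    using linear_permute_vars[of \<sigma>] unfolding bilinear_def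
    by (auto intro!: linearI simp: algebra_simps rpoly_mult_scaleR linear_add linear_scale)
  fix a b :: "'a mono"
  show "permute_vars \<sigma> (rmonom a * rmonom b) = permute_vars \<sigma> (rmonom a) * permute_vars \<sigma> (rmonom b)"
    unfolding rmonom_mult
    by (simp add: permute_vars_def rmonom_def lookup_add power_add prod.distrib)
qed

lemma tens_act_tensor: "tens_act \<sigma> (d \<otimes> f) = permute_vars \<sigma> d \<otimes> permute_vars \<sigma> f"
proof -
  have "bilinear (\<lambda>d f. permute_vars \<sigma> d \<otimes> permute_vars \<sigma> f)"
    unfolding bilinear_def
    by (auto intro!: linearI simp: bilinear_ladd[OF bilinear_tensor] bilinear_radd[OF bilinear_tensor]
      bilinear_lmul[OF bilinear_tensor] bilinear_rmul[OF bilinear_tensor]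
      linear_add[OF linear_permute_vars] linear_scale[OF linear_permute_vars])
  then show ?thesis unfolding tens_act_def by (rule tensor_lift_tensor)
qed

lemma permute_vars_compose: "permute_vars \<sigma> (permute_vars \<tau> p) = permute_vars (\<sigma> \<circ> \<tau>) p"
proof (rule linear_eq_on_monomials[of "\<lambda>p. permute_vars \<sigma> (permute_vars \<tau> p)"])
  show "linear (\<lambda>p. permute_vars \<sigma> (permute_vars \<tau> p))"
    using linear_compose[OF linear_permute_vars linear_permute_vars] by (simp add: o_def)
  fix a :: "'a mono"
  have pow: "permute_vars \<sigma> (p ^ r) = permute_vars \<sigma> p ^ r" for p r
    by (induction r) (simp_all add: permute_vars_1 permute_vars_mult)
  have "permute_vars \<sigma> (\<Prod>k\<in>A. pvar (\<tau> k) ^ lookup a k)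
      = (\<Prod>k\<in>A. pvar (\<sigma> (\<tau> k)) ^ lookup a k)" if "finite A" for A
    using that
    by (induction A) (simp_all add: permute_vars_1 permute_vars_mult pow permute_vars_pvar)
  from this[of UNIV] show "permute_vars \<sigma> (permute_vars \<tau> (Poly_Mapping.single a 1))
      = permute_vars (\<sigma> \<circ> \<tau>) (Poly_Mapping.single a 1)"
    by (simp add: permute_vars_def[of \<tau>] permute_vars_def[of "\<sigma> \<circ> \<tau>"])
qed (rule linear_permute_vars)

lemma linear_tens_act: "linear (tens_act \<sigma>)"
  unfolding tens_act_def by (rule linear_tensor_lift)

lemma tens_act_compose: "tens_act \<sigma> (tens_act \<tau> t) = tens_act (\<sigma> \<circ> \<tau>) t"
proof -
  have "linear (\<lambda>t. tens_act \<sigma> (tens_act \<tau> t))"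
    using linear_compose[OF linear_tens_act linear_tens_act] by (simp add: o_def)
  from tensor_lift_unique[OF this, of "\<lambda>d f. permute_vars (\<sigma> \<circ> \<tau>) d \<otimes> permute_vars (\<sigma> \<circ> \<tau>) f"]
  show ?thesis
    by (simp add: tens_act_tensor permute_vars_compose tens_act_def[of "\<sigma> \<circ> \<tau>"] fun_eq_iff)
qed

lemma mdeg_add: "mdeg (a + b) = mdeg a + mdeg b"
  by (simp add: mdeg_def lookup_add sum.distrib)

lemma mdeg_single: "mdeg (Poly_Mapping.single k r) = r"
  by (simp add: mdeg_def lookup_single when_def)

lemma permute_vars_rmonom:
  "permute_vars \<sigma> (rmonom a) = rmonom (\<Sum>k\<in>UNIV. Poly_Mapping.single (\<sigma> k) (lookup a k))"
proof -
  have pow: "pvar k ^ r = rmonom (Poly_Mapping.single k r)" for k :: 'a and r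
    by (induction r) (simp_all add: rmonom_0 pvar_def rmonom_mult single_add[symmetric])
  have "(\<Prod>k\<in>A. pvar (\<sigma> k) ^ lookup a k)
      = rmonom (\<Sum>k\<in>A. Poly_Mapping.single (\<sigma> k) (lookup a k))" if "finite A" for A
    using that by (induction A) (simp_all add: rmonom_0 pow rmonom_mult)
  from this[of UNIV] show ?thesis
    by (simp add: permute_vars_def rmonom_def[of a])
qed

lemma permute_vars_homog:
  assumes "p \<in> homog i"
  shows "permute_vars \<sigma> p \<in> homog i"
proof -
  have deg: "mdeg (\<Sum>k\<in>A. Poly_Mapping.single (\<sigma> k) (lookup a k)) = (\<Sum>k\<in>A. lookup a k)"
    if "finite A" for A and a :: "'a mono"
    using that
  proof (induction A)
    case empty
    show ?case by (simp add: mdeg_def)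
  qed (simp add: mdeg_add mdeg_single)
  have "permute_vars \<sigma> p = (\<Sum>a\<in>keys p. lookup p a *\<^sub>R permute_vars \<sigma> (rmonom a))"
    by (simp add: permute_vars_def lin_ext_def[of _ p] rmonom_def)
  moreover have "mdeg b = i"
    if b: "b \<in> keys (\<Sum>a\<in>keys p. lookup p a *\<^sub>R permute_vars \<sigma> (rmonom a))" for b
  proof -
    from subsetD[OF keys_sum b] obtain a where a: "a \<in> keys p"
      "b \<in> keys (lookup p a *\<^sub>R permute_vars \<sigma> (rmonom a))" by blast
    define c where "c = (\<Sum>k\<in>UNIV. Poly_Mapping.single (\<sigma> k) (lookup a k))"
    have "b = c"
      using a(2) unfolding permute_vars_rmonom c_def[symmetric]
      by (cases "b = c") (simp_all add: rmonom_def in_keys_iff lookup_single)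
    moreover have "mdeg c = mdeg a"
      using deg[of UNIV a] by (simp add: c_def mdeg_def[of a])
    ultimately show ?thesis
      using a(1) assms by (simp add: homog_def)
  qed
  ultimately show ?thesis by (simp add: homog_def)
qed

lemma tens_act_H_piece:
  assumes "t \<in> H_piece m j"
  shows "tens_act \<sigma> t \<in> H_piece m j"
  using assms unfolding H_piece_def
proof (induction rule: span_induct_alt)
  case base
  show ?case by (simp add: linear_0[OF linear_tens_act] span_zero)
next
  case (step c x y)
  then obtain d f i where "x = d \<otimes> f"
    and i: "i \<le> m" "j = - int m + 2 * int i" "d \<in> homog i" "f \<in> homog (m - i)"
    by blast
  then have "tens_act \<sigma> x = permute_vars \<sigma> d \<otimes> permute_vars \<sigma> f"
    by (simp add: tens_act_tensor)
  then have "tens_act \<sigma> x \<in> {d \<otimes> f | d f i. i \<le> m \<and> j = - int m + 2 * int i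
                                 \<and> d \<in> homog i \<and> f \<in> homog (m - i)}"
    using i by (blast intro: permute_vars_homog)
  then show ?case
    using step by (simp add: linear_add[OF linear_tens_act] linear_scale[OF linear_tens_act]
        span_add span_scale span_base)
qed

lemma lookup_tensor: "lookup (d \<otimes> f) (a, b) = lookup d a * lookup f b"
proof (rule bilinear_eq_on_monomials
    [of "\<lambda>d f. lookup (d \<otimes> f) (a, b)" "\<lambda>d f. lookup d a * lookup f b"])
  show "bilinear (\<lambda>d f. lookup (d \<otimes> f) (a, b))"
    "bilinear (\<lambda>d f. lookup d a * lookup f b :: real)"
    unfolding bilinear_def
    by (auto intro!: linearI simp: lookup_add algebra_simps
        bilinear_ladd[OF bilinear_tensor] bilinear_radd[OF bilinear_tensor]
        bilinear_lmul[OF bilinear_tensor] bilinear_rmul[OF bilinear_tensor])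
qed (unfold tensor_rmonom, auto simp: rmonom_def lookup_single when_def)

text \<open>
  Distinct graded pieces involve disjoint sets of basis elements, so their sum is direct.
\<close>

lemma H_piece_iff:
  "t \<in> H_piece m j \<longleftrightarrow>
     (\<forall>(a, b)\<in>keys t. mdeg a + mdeg b = m \<and> j = - int m + 2 * int (mdeg a))"
  (is "_ \<longleftrightarrow> ?P t")
proof
  assume "t \<in> H_piece m j"
  then show "?P t" unfolding H_piece_def
  proof (induction rule: span_induct_alt)
    case (step c x y)
    then obtain d f i where "x = d \<otimes> f"
      and i: "i \<le> m" "j = - int m + 2 * int i" "d \<in> homog i" "f \<in> homog (m - i)"
      by blast
    then have x: "?P x"
      by (auto simp: in_keys_iff lookup_tensor homog_def)
    show ?case
    proof (clarify)
      fix a b assume "(a, b) \<in> keys (c *\<^sub>R x + y)"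
      then have "(a, b) \<in> keys x \<or> (a, b) \<in> keys y"
        by (auto simp: in_keys_iff lookup_add)
      then show "mdeg a + mdeg b = m \<and> j = - int m + 2 * int (mdeg a)"
        using x step.IH by auto
    qed
  qed simp
next
  assume P: "?P t"
  have "lookup t c *\<^sub>R Poly_Mapping.single c 1 \<in> H_piece m j" if c: "c \<in> keys t" for c
  proof -
    obtain a b where ab: "c = (a, b)" by (cases c)
    with P c have deg: "mdeg a + mdeg b = m" "j = - int m + 2 * int (mdeg a)" by auto
    have "rmonom a \<otimes> rmonom b \<in> {d \<otimes> f | d f i. i \<le> m \<and> j = - int m + 2 * int i
                                 \<and> d \<in> homog i \<and> f \<in> homog (m - i)}"
    proof (intro CollectI exI conjI)
      show "rmonom a \<in> homog (mdeg a)" "rmonom b \<in> homog (m - mdeg a)"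
        using deg by (auto simp: homog_def rmonom_def)
    qed (use deg in auto)
    then show ?thesis
      unfolding ab H_piece_def tensor_rmonom[symmetric] by (intro span_scale span_base)
  qed
  then have "(\<Sum>c\<in>keys t. lookup t c *\<^sub>R Poly_Mapping.single c 1) \<in> H_piece m j"
    unfolding H_piece_def by (intro span_sum)
  then show "t \<in> H_piece m j"
    by (subst poly_mapping_expand[of t])
qed

end

theory Submission
  imports Defs
begin

text \<open>
  Regard an element of \<open>D \<otimes> R\<close> as a polynomial \<open>F(d, x)\<close> in two vectors of variables. Then
  \<open>L = \<Sum>\<^sub>k d\<^sub>k \<partial>/\<partial>x\<^sub>k\<close>, and together with \<open>\<Lambda> = \<Sum>\<^sub>k x\<^sub>k \<partial>/\<partial>d\<^sub>k\<close> it spans a copy of \<open>sl\<^sub>2\<close>: the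
  commutator \<open>[L, \<Lambda>]\<close> is the difference of the degrees in \<open>d\<close> and in \<open>x\<close> (\<open>Lop_Lambda_op\<close>). The
  swap \<open>s F(d, x) = F(x, d)\<close> exchanges \<open>L\<close> and \<open>\<Lambda>\<close>.

  Hard Lefschetz is \<open>sl\<^sub>2\<close> theory: \<open>\<Lambda>\<close> is nilpotent on every piece, which forces \<open>L\<^sup>r\<close> to be
  injective in weight \<open>-r\<close> (\<open>sl2_action.e_pow_inj\<close>), and the swap shows that source and target have
  the same finite dimension. The same theory shows that a primitive element is killed by \<open>\<Lambda>\<close>
  (\<open>sl2_action.primitive_lowest_weight\<close>).

  The pairing is related to the swap: monomials pair by \<open>(d\<^sup>a, x\<^sup>b) = a!\<close> if \<open>a = b\<close> and \<open>0\<close>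
  otherwise, so \<open>(F, G) \<mapsto> \<langle>F, s G\<rangle>\<close> is diagonal on monomials with positive entries \<open>a! b!\<close>
  (\<open>pairing_swap_pos\<close>). Non-degeneracy follows at once. For the Hodge--Riemann relations it
  remains to compare \<open>L\<^sup>r F\<close> with \<open>s F\<close> for a primitive \<open>F\<close> of bidegree \<open>(i, i + r)\<close>, and the answer
  is \<open>L\<^sup>r F = (-1)\<^sup>i r! s F\<close> (\<open>Lop_pow_lowest_weight\<close>), whence
  \<open>(-1)\<^sup>i \<langle>F, L\<^sup>r F\<rangle> = r! \<langle>F, s F\<rangle> > 0\<close>.

  A conceptual reason for this identity: \<open>e\<^bsup>tL\<^esup> F = F(d, x + td)\<close>, while \<open>\<Lambda> F = 0\<close> says that
  \<open>F(d + ux, x) = F(d, x)\<close> for all \<open>u\<close>. Shifting the first argument by \<open>-1/t\<close> times the second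
  gives \<open>F(d, x + td) = F(-x/t, x + td) = (-1)\<^sup>i t\<^sup>r F(x, d + x/t)\<close>, and the coefficients of \<open>t\<^sup>r\<close> are
  \<open>L\<^sup>r F / r!\<close> and \<open>(-1)\<^sup>i F(x, d)\<close>. The proof below reaches the same identity without exponentials,
  by induction on \<open>i\<close> through partial derivatives.
\<close>

section \<open>Linear algebra\<close>

lemma linear_sum_ops:
  assumes "\<And>k. k \<in> A \<Longrightarrow> linear (F k)"
  shows "linear (\<lambda>t. \<Sum>k\<in>A. F k t)"
  using assms by (intro linear_compose_sum) auto

lemma linear_funpow:
  fixes F :: "'v::real_vector \<Rightarrow> 'v"
  assumes "linear F"
  shows "linear (F ^^ n)"
proof (induction n)
  case 0
  show ?case by (simp add: linear_id[unfolded id_def] id_def)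
next
  case (Suc n)
  then show ?case unfolding funpow.simps by (rule linear_compose) (rule assms)
qed

text \<open>
  The pieces of \<open>D \<otimes> R\<close> are finite-dimensional although the ambient space is not, so the dimension
  count takes place inside the span of a finite set.
\<close>

lemma injective_endo_of_finite_span_surj:
  fixes g :: "'v::real_vector \<Rightarrow> 'v"
  assumes g: "linear g" and T: "finite T" and into: "g ` span T \<subseteq> span T"
    and ker: "\<And>x. x \<in> span T \<Longrightarrow> g x = 0 \<Longrightarrow> x = 0"
  shows "g ` span T = span T"
proof -
  obtain B where B: "B \<subseteq> T" "independent B" "T \<subseteq> span B"
    using maximal_independent_subset by blast
  have sp: "span B = span T"
    using span_mono[OF B(1)] span_minimal[OF B(3) subspace_span] by (rule subset_antisym)
  have fB: "finite B" using B T finite_subset by blast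
  have inj: "inj_on g (span B)"
    unfolding linear_inj_on_iff_eq_0[OF g subspace_span] sp using ker by blast
  have ind: "independent (g ` B)"
    using linear_independent_injective_image[OF g B(2) inj] .
  have card: "card (g ` B) = card B"
    by (intro card_image inj_on_subset[OF inj]) (rule span_superset)
  have sub: "g ` B \<subseteq> span B"
    using into sp span_superset[of B] by blast
  have "B \<subseteq> span (g ` B)"
  proof
    fix x assume x: "x \<in> B"
    show "x \<in> span (g ` B)"
    proof (rule ccontr)
      assume new: "x \<notin> span (g ` B)"
      then have "independent (insert x (g ` B))"
        using ind by (rule independent_insertI)
      moreover have "insert x (g ` B) \<subseteq> span B"
        using sub x span_base[of x B] by simp
      ultimately have "card (insert x (g ` B)) \<le> card B"
        by (rule independent_span_bound[OF fB, THEN conjunct2])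
      moreover have "x \<notin> g ` B" using new span_superset[of "g ` B"] by (rule contra_subsetD[rotated])
      ultimately show False using card fB by simp
    qed
  qed
  then have "span B \<subseteq> span (g ` B)"
    by (rule span_minimal) (rule subspace_span)
  then have "span T \<subseteq> g ` span T"
    by (simp only: sp[symmetric] linear_span_image[OF g])
  with into show ?thesis by (rule subset_antisym)
qed


section \<open>Representations of \<open>sl\<^sub>2\<close>\<close>

text \<open>
  The relations are imposed on the whole ambient space and weights are eigenvalues of \<open>h\<close>, so that no
  grading and no finite dimension enters; finiteness appears only as nilpotency of \<open>f\<close> on a vector.
\<close>

locale sl2_action =
  fixes e f h :: "'v::real_vector \<Rightarrow> 'v"
  assumes lin_e: "linear e" and lin_f: "linear f" and lin_h: "linear h"
    and e_f: "e (f v) = f (e v) + h v"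
    and h_e: "h (e v) = e (h v) + 2 *\<^sub>R e v"
    and h_f: "h (f v) = f (h v) - 2 *\<^sub>R f v"
begin

lemma weight_e_pow:
  assumes "h v = c *\<^sub>R v"
  shows "h ((e ^^ n) v) = (c + 2 * real n) *\<^sub>R (e ^^ n) v"
  by (induction n)
     (use assms in \<open>simp_all add: h_e linear_add[OF lin_e] linear_scale[OF lin_e] algebra_simps\<close>)

lemma weight_f:
  assumes "h v = c *\<^sub>R v"
  shows "h (f v) = (c - 2) *\<^sub>R f v"
  using assms by (simp add: h_f linear_scale[OF lin_f] algebra_simps)

lemma e_pow_f:
  assumes "h v = c *\<^sub>R v"
  shows "(e ^^ Suc n) (f v) = f ((e ^^ Suc n) v) + (real (Suc n) * (c + real n)) *\<^sub>R (e ^^ n) v"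
proof (induction n)
  case 0
  show ?case using assms by (simp add: e_f)
next
  case (Suc n)
  have "(e ^^ Suc (Suc n)) (f v) = e ((e ^^ Suc n) (f v))" by simp
  also have "\<dots> = e (f ((e ^^ Suc n) v)) + (real (Suc n) * (c + real n)) *\<^sub>R (e ^^ Suc n) v"
    unfolding Suc by (simp add: linear_add[OF lin_e] linear_scale[OF lin_e])
  also have "e (f ((e ^^ Suc n) v)) = f ((e ^^ Suc (Suc n)) v) + h ((e ^^ Suc n) v)"
    by (simp add: e_f)
  also have "h ((e ^^ Suc n) v) = (c + 2 * real (Suc n)) *\<^sub>R (e ^^ Suc n) v"
    using assms by (rule weight_e_pow)
  finally show ?case
    by (simp only: add.assoc scaleR_add_left[symmetric]) (simp add: algebra_simps)
qed

text \<open>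
  On a vector killed by \<open>f\<close>, applying \<open>f\<close> undoes one factor of \<open>e\<close> up to the scalar
  \<open>(n + 1) (w - n)\<close>, which is nonzero as long as \<open>n < w\<close>.
\<close>

lemma lowest_weight_e_pow_inj:
  assumes "f v = 0" "h v = - real w *\<^sub>R v" "(e ^^ n) v = 0" "n \<le> w"
  shows "v = 0"
  using assms(3,4)
proof (induction n)
  case (Suc n)
  have "(real (Suc n) * (- real w + real n)) *\<^sub>R (e ^^ n) v = 0"
    using e_pow_f[OF assms(2), of n]
    unfolding assms(1) Suc.prems(1) linear_0[OF lin_f] linear_0[OF linear_funpow[OF lin_e]] add_0_left
    by (rule sym)
  then have "(e ^^ n) v = 0" using Suc.prems(2) by auto
  then show ?case using Suc by simp
qed simp

text \<open>
  Induction on the order of nilpotency of \<open>f\<close>: by \<open>e_pow_f\<close> the vector \<open>f v\<close>, of weight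
  \<open>-(w + 2)\<close>, is killed by \<open>e\<^bsup>n+1\<^esup>\<close>, hence vanishes by induction, and \<open>v\<close> is a lowest weight vector.
\<close>

lemma e_pow_inj:
  assumes "(f ^^ p) v = 0" "h v = - real w *\<^sub>R v" "(e ^^ n) v = 0" "n \<le> w"
  shows "v = 0"
  using assms
proof (induction p arbitrary: v w n)
  case (Suc p)
  have "f v = 0"
  proof (rule Suc.IH)
    show "(f ^^ p) (f v) = 0" using Suc.prems(1) by (simp add: funpow_swap1)
    show "h (f v) = - real (w + 2) *\<^sub>R f v"
      using weight_f[OF Suc.prems(2)] by simp
    show "(e ^^ Suc n) (f v) = 0"
      unfolding e_pow_f[OF Suc.prems(2)] using Suc.prems(3)
      by (simp add: linear_0[OF lin_f] linear_0[OF lin_e])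
    show "Suc n \<le> w + 2" using Suc.prems(4) by simp
  qed
  then show ?case using lowest_weight_e_pow_inj Suc.prems by blast
qed simp

text \<open>
  In \<open>e_pow_f\<close> with exponent \<open>w + 2\<close> both terms on the right vanish, so \<open>f v\<close>, of weight
  \<open>-(w + 2)\<close>, is covered by \<open>e_pow_inj\<close>.
\<close>

lemma primitive_lowest_weight:
  assumes "(f ^^ p) v = 0" "h v = - real w *\<^sub>R v" "(e ^^ Suc w) v = 0"
  shows "f v = 0"
proof (rule e_pow_inj)
  show "(f ^^ p) (f v) = 0"
    using assms(1) by (metis funpow_swap1 linear_0[OF lin_f])
  show "h (f v) = - real (w + 2) *\<^sub>R f v"
    using weight_f[OF assms(2)] by simp
  show "(e ^^ Suc (Suc w)) (f v) = 0"
    unfolding e_pow_f[OF assms(2)] funpow.simps(2)[of "Suc w"] comp_apply assms(3)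
    by (simp add: linear_0[OF lin_f] linear_0[OF lin_e])
qed simp

end


section \<open>Homogeneous polynomials\<close>

lemma linear_pvar_mult: "linear (\<lambda>p. pvar k * p)"
  by (rule bilinear_mult[unfolded bilinear_def, THEN conjunct1, rule_format])

lemma rmonom_homog: "mdeg a = i \<Longrightarrow> rmonom a \<in> homog i"
  by (simp add: homog_def rmonom_def)

lemma homog_eq_span: "homog i = span {rmonom a | a. mdeg a = i}"
proof
  show "homog i \<subseteq> span {rmonom a | a :: 'a mono. mdeg a = i}"
  proof
    fix p :: "'a rpoly" assume p: "p \<in> homog i"
    have "(\<Sum>a\<in>keys p. lookup p a *\<^sub>R rmonom a) \<in> span {rmonom a | a. mdeg a = i}"
      using p by (intro span_sum span_scale span_base) (auto simp: homog_def)
    then show "p \<in> span {rmonom a | a. mdeg a = i}"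
      by (subst poly_mapping_expand) (simp add: rmonom_def)
  qed
  have "subspace (homog i :: 'a rpoly set)"
    by (auto simp: subspace_def homog_def in_keys_iff lookup_add)
  then show "span {rmonom a | a. mdeg a = i} \<subseteq> (homog i :: 'a rpoly set)"
    by (intro span_minimal) (auto intro: rmonom_homog)
qed

lemma homog_induct [consumes 1, case_names monom zero scale_add]:
  assumes "p \<in> homog i" "\<And>a. mdeg a = i \<Longrightarrow> P (rmonom a)" "P 0"
    "\<And>c p q. P p \<Longrightarrow> P q \<Longrightarrow> P (c *\<^sub>R p + q)"
  shows "P p"
proof -
  have "p \<in> span {rmonom a | a. mdeg a = i}" using assms(1) by (simp add: homog_eq_span)
  then show ?thesis
    by (induction rule: span_induct_alt) (use assms in auto)
qed

lemma subspace_homog: "subspace (homog i)"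
  by (simp add: homog_eq_span)

lemma mono_split:
  fixes a :: "'n mono"
  assumes "lookup a k \<noteq> 0"
  shows "Poly_Mapping.single k 1 + (a - Poly_Mapping.single k 1) = a"
  using assms by (intro poly_mapping_eqI) (auto simp: lookup_add lookup_minus lookup_single when_def)

lemma mdeg_minus_single:
  assumes "lookup a k \<noteq> 0"
  shows "mdeg a = Suc (mdeg (a - Poly_Mapping.single k 1))"
  by (subst mono_split[OF assms, symmetric]) (simp only: mdeg_add mdeg_single)

lemma mdeg_eq_0: "mdeg a = 0 \<longleftrightarrow> a = 0"
  by (auto simp: mdeg_def poly_mapping_eq_iff fun_eq_iff)

lemma pvar_mult_homog: "p \<in> homog i \<Longrightarrow> pvar k * p \<in> homog (Suc i)"
proof (induction rule: homog_induct)
  case (monom a)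
  then show ?case by (simp add: pvar_def rmonom_mult rmonom_homog mdeg_add mdeg_single)
next
  case (scale_add c p q)
  then show ?case
    by (simp add: linear_add[OF linear_pvar_mult] linear_scale[OF linear_pvar_mult]
        subspace_add[OF subspace_homog] subspace_scale[OF subspace_homog])
qed (simp add: subspace_0[OF subspace_homog])

lemma pdiff_homog: "p \<in> homog (Suc i) \<Longrightarrow> pdiff k p \<in> homog i"
proof (induction rule: homog_induct)
  case (monom a)
  show ?case
  proof (cases "lookup a k = 0")
    case False
    then show ?thesis using monom mdeg_minus_single[of a k]
      by (auto simp: pdiff_rmonom intro: subspace_scale[OF subspace_homog] rmonom_homog)
  qed (simp add: pdiff_rmonom subspace_0[OF subspace_homog])
next
  case (scale_add c p q)
  then show ?case
    by (simp add: linear_add[OF linear_pdiff] linear_scale[OF linear_pdiff]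
        subspace_add[OF subspace_homog] subspace_scale[OF subspace_homog])
qed (simp add: subspace_0[OF subspace_homog] linear_0[OF linear_pdiff])

lemma pdiff_homog_0: "p \<in> homog 0 \<Longrightarrow> pdiff k p = 0"
  by (induction rule: homog_induct)
     (simp_all add: mdeg_eq_0 pdiff_rmonom linear_0[OF linear_pdiff] linear_add[OF linear_pdiff]
        linear_scale[OF linear_pdiff])

definition euler :: "'n::finite rpoly \<Rightarrow> 'n rpoly" where
  "euler p = (\<Sum>k\<in>UNIV. pvar k * pdiff k p)"

lemma linear_euler: "linear euler"
  unfolding euler_def
  by (intro linear_sum_ops linear_compose[OF linear_pdiff linear_pvar_mult, unfolded o_def])

lemma euler_rmonom: "euler (rmonom a) = real (mdeg a) *\<^sub>R rmonom a"
proof -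
  have "pvar k * pdiff k (rmonom a) = real (lookup a k) *\<^sub>R rmonom a" for k
  proof (cases "lookup a k = 0")
    case False
    then show ?thesis
      using mono_split[OF False] by (simp add: pdiff_rmonom rpoly_mult_scaleR pvar_def rmonom_mult)
  qed (simp add: pdiff_rmonom)
  then show ?thesis by (simp add: euler_def mdeg_def scaleR_sum_left)
qed

lemma euler_homog: "p \<in> homog i \<Longrightarrow> euler p = real i *\<^sub>R p"
  by (induction rule: homog_induct)
     (simp_all add: euler_rmonom linear_0[OF linear_euler] linear_add[OF linear_euler]
        linear_scale[OF linear_euler] algebra_simps)

lemma pdiff_pvar_mult: "pdiff j (pvar k * p) = (if j = k then p else 0) + pvar k * pdiff j p"
  by (simp add: pdiff_mult pdiff_pvar)

lemma euler_pvar_mult: "euler (pvar k * p) = pvar k * euler p + pvar k * p"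
proof -
  have "euler (pvar k * p) = (\<Sum>j\<in>UNIV. (if j = k then pvar k * p else 0) + pvar k * (pvar j * pdiff j p))"
    unfolding euler_def by (intro sum.cong) (auto simp: pdiff_pvar_mult distrib_left mult.left_commute[of "pvar k"])
  then show ?thesis by (simp add: sum.distrib euler_def sum_distrib_left)
qed

lemma euler_pdiff: "euler (pdiff k p) = pdiff k (euler p) - pdiff k p"
proof -
  have "pdiff k (euler p) = (\<Sum>j\<in>UNIV. (if k = j then pdiff k p else 0) + pvar j * pdiff j (pdiff k p))"
    unfolding euler_def linear_sum[OF linear_pdiff]
    by (intro sum.cong refl) (auto simp: pdiff_pvar_mult pdiff_commute)
  then show ?thesis by (simp add: sum.distrib euler_def)
qed


section \<open>Operators on the tensor product\<close>

lemmas tensor_bilin =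
  bilinear_ladd[OF bilinear_tensor] bilinear_radd[OF bilinear_tensor]
  bilinear_lmul[OF bilinear_tensor] bilinear_rmul[OF bilinear_tensor]
  bilinear_lzero[OF bilinear_tensor] bilinear_rzero[OF bilinear_tensor]
  bilinear_lsub[OF bilinear_tensor] bilinear_rsub[OF bilinear_tensor]

lemma tensor_sum_left: "(\<Sum>k\<in>A. p k) \<otimes> q = (\<Sum>k\<in>A. p k \<otimes> q)"
  by (rule linear_sum[OF bilinear_tensor[unfolded bilinear_def, THEN conjunct2, rule_format]])

lemma tensor_sum_right: "q \<otimes> (\<Sum>k\<in>A. p k) = (\<Sum>k\<in>A. q \<otimes> p k)"
  by (rule linear_sum[OF bilinear_tensor[unfolded bilinear_def, THEN conjunct1, rule_format]])

lemma linear_eq_on_tensors: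
  assumes "linear F" "linear G" "\<And>d f. F (d \<otimes> f) = G (d \<otimes> f)"
  shows "F t = G t"
  using tensor_lift_unique[OF assms(1), of "\<lambda>d f. G (d \<otimes> f)"]
    tensor_lift_unique[OF assms(2), of "\<lambda>d f. G (d \<otimes> f)"] assms(3) by simp

text \<open>
  Meaningful only for linear \<open>A\<close> and \<open>B\<close>, where it is the tensor product of the two maps.
\<close>

definition tens_map :: "('n rpoly \<Rightarrow> 'n rpoly) \<Rightarrow> ('n rpoly \<Rightarrow> 'n rpoly) \<Rightarrow> 'n tens \<Rightarrow> 'n tens" where
  "tens_map A B = tensor_lift (\<lambda>d f. A d \<otimes> B f)"

lemma linear_tens_map: "linear (tens_map A B)"
  unfolding tens_map_def by (rule linear_tensor_lift)

lemma tens_map_tensor: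
  assumes "linear A" "linear B"
  shows "tens_map A B (d \<otimes> f) = A d \<otimes> B f"
  unfolding tens_map_def
  by (rule tensor_lift_tensor)
     (auto simp: bilinear_def tensor_bilin linear_add[OF assms(1)] linear_add[OF assms(2)]
        linear_scale[OF assms(1)] linear_scale[OF assms(2)] intro!: linearI)

definition diff_left :: "'n \<Rightarrow> 'n tens \<Rightarrow> 'n tens" where
  "diff_left k = tens_map (pdiff k) id"

definition diff_right :: "'n \<Rightarrow> 'n tens \<Rightarrow> 'n tens" where
  "diff_right k = tens_map id (pdiff k)"

definition mult_right :: "'n \<Rightarrow> 'n tens \<Rightarrow> 'n tens" where
  "mult_right k = tens_map id (\<lambda>p. pvar k * p)"

definition Lambda_op :: "'n::finite tens \<Rightarrow> 'n tens" where
  "Lambda_op t = (\<Sum>k\<in>UNIV. tens_map (pdiff k) (\<lambda>p. pvar k * p) t)"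

definition weight_op :: "'n::finite tens \<Rightarrow> 'n tens" where
  "weight_op t = tens_map euler id t - tens_map id euler t"

definition tens_swap :: "'n tens \<Rightarrow> 'n tens" where
  "tens_swap = tensor_lift (\<lambda>d f. f \<otimes> d)"

lemma diff_left_tensor: "diff_left k (d \<otimes> f) = pdiff k d \<otimes> f"
  by (simp add: diff_left_def tens_map_tensor linear_pdiff linear_id)

lemma diff_right_tensor: "diff_right k (d \<otimes> f) = d \<otimes> pdiff k f"
  by (simp add: diff_right_def tens_map_tensor linear_pdiff linear_id)

lemma mult_right_tensor: "mult_right k (d \<otimes> f) = d \<otimes> (pvar k * f)"
  by (simp add: mult_right_def tens_map_tensor linear_pvar_mult linear_id)

lemma Lambda_op_tensor: "Lambda_op (d \<otimes> f) = (\<Sum>k\<in>UNIV. pdiff k d \<otimes> (pvar k * f))"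
  by (simp add: Lambda_op_def tens_map_tensor linear_pdiff linear_pvar_mult)

lemma weight_op_tensor: "weight_op (d \<otimes> f) = euler d \<otimes> f - d \<otimes> euler f"
  by (simp add: weight_op_def tens_map_tensor linear_euler linear_id)

lemma tens_swap_tensor: "tens_swap (d \<otimes> f) = f \<otimes> d"
  unfolding tens_swap_def
  by (rule tensor_lift_tensor) (auto simp: bilinear_def tensor_bilin intro!: linearI)

lemma linear_Lop: "linear Lop"
  unfolding Lop_def by (rule linear_tensor_lift)

lemma linear_Lambda_op: "linear Lambda_op"
  unfolding Lambda_op_def by (intro linear_sum_ops linear_tens_map)

lemma linear_weight_op: "linear weight_op"
  unfolding weight_op_def by (intro linear_compose_sub linear_tens_map)

lemma linear_tens_swap: "linear tens_swap"
  unfolding tens_swap_def by (rule linear_tensor_lift)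

lemma linear_diff_left: "linear (diff_left k)"
  unfolding diff_left_def by (rule linear_tens_map)

lemma linear_diff_right: "linear (diff_right k)"
  unfolding diff_right_def by (rule linear_tens_map)

lemma linear_mult_right: "linear (mult_right k)"
  unfolding mult_right_def by (rule linear_tens_map)

lemmas tens_op_linear = linear_Lop linear_Lambda_op linear_weight_op linear_tens_swap
  linear_diff_left linear_diff_right linear_mult_right

lemmas tens_op_linear_comp =
  linear_compose[OF tens_op_linear(1), unfolded o_def] linear_compose[OF tens_op_linear(2), unfolded o_def]
  linear_compose[OF tens_op_linear(3), unfolded o_def] linear_compose[OF tens_op_linear(4), unfolded o_def]
  linear_compose[OF tens_op_linear(5), unfolded o_def] linear_compose[OF tens_op_linear(6), unfolded o_def]
  linear_compose[OF tens_op_linear(7), unfolded o_def]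

lemmas tens_op_tensor = Lop_tensor Lambda_op_tensor weight_op_tensor tens_swap_tensor
  diff_left_tensor diff_right_tensor mult_right_tensor

text \<open>
  Both products contain the terms \<open>d\<^sub>j x\<^sub>k \<partial>/\<partial>d\<^sub>k \<partial>/\<partial>x\<^sub>j\<close>; what is left are the two Euler operators
  that the Leibniz rule produces for \<open>j = k\<close>.
\<close>

lemma Lop_Lambda_op: "Lop (Lambda_op t) = Lambda_op (Lop t) + weight_op t"
proof (rule linear_eq_on_tensors[of "\<lambda>t. Lop (Lambda_op t)" "\<lambda>t. Lambda_op (Lop t) + weight_op t"])
  show "linear (\<lambda>t::'a tens. Lop (Lambda_op t))" "linear (\<lambda>t::'a tens. Lambda_op (Lop t) + weight_op t)"
    by (intro linear_compose_add tens_op_linear_comp tens_op_linear)+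
  fix d f :: "'a rpoly"
  let ?c = "\<lambda>j k. (pvar j * pdiff k d) \<otimes> (pvar k * pdiff j f)"
  have "Lop (Lambda_op (d \<otimes> f))
      = (\<Sum>k\<in>UNIV. \<Sum>j\<in>UNIV. (pvar j * pdiff k d) \<otimes> pdiff j (pvar k * f))"
    by (simp add: Lambda_op_tensor Lop_tensor linear_sum[OF linear_Lop])
  also have "\<dots> = (\<Sum>k\<in>UNIV. \<Sum>j\<in>UNIV. (if j = k then (pvar k * pdiff k d) \<otimes> f else 0) + ?c j k)"
    by (intro sum.cong) (auto simp: pdiff_pvar_mult tensor_bilin)
  finally have 1: "Lop (Lambda_op (d \<otimes> f)) = euler d \<otimes> f + (\<Sum>k\<in>UNIV. \<Sum>j\<in>UNIV. ?c j k)"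
    by (simp add: sum.distrib euler_def tensor_sum_left)
  have "Lambda_op (Lop (d \<otimes> f))
      = (\<Sum>j\<in>UNIV. \<Sum>k\<in>UNIV. pdiff k (pvar j * d) \<otimes> (pvar k * pdiff j f))"
    by (simp add: Lambda_op_tensor Lop_tensor linear_sum[OF linear_Lambda_op])
  also have "\<dots> = (\<Sum>j\<in>UNIV. \<Sum>k\<in>UNIV. (if k = j then d \<otimes> (pvar j * pdiff j f) else 0) + ?c j k)"
    by (intro sum.cong) (auto simp: pdiff_pvar_mult tensor_bilin)
  finally have 2: "Lambda_op (Lop (d \<otimes> f)) = d \<otimes> euler f + (\<Sum>j\<in>UNIV. \<Sum>k\<in>UNIV. ?c j k)"
    by (simp add: sum.distrib euler_def tensor_sum_right)
  show "Lop (Lambda_op (d \<otimes> f)) = Lambda_op (Lop (d \<otimes> f)) + weight_op (d \<otimes> f)"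
    unfolding 1 2 weight_op_tensor by (subst sum.swap) simp
qed

lemma weight_op_Lop: "weight_op (Lop t) = Lop (weight_op t) + 2 *\<^sub>R Lop t"
proof (rule linear_eq_on_tensors[of "\<lambda>t. weight_op (Lop t)" "\<lambda>t. Lop (weight_op t) + 2 *\<^sub>R Lop t"])
  show "linear (\<lambda>t::'a tens. weight_op (Lop t))" "linear (\<lambda>t::'a tens. Lop (weight_op t) + 2 *\<^sub>R Lop t)"
    by (intro linear_compose_add linear_compose_scale_right tens_op_linear_comp tens_op_linear)+
  fix d f :: "'a rpoly"
  show "weight_op (Lop (d \<otimes> f)) = Lop (weight_op (d \<otimes> f)) + 2 *\<^sub>R Lop (d \<otimes> f)"
    by (simp add: tens_op_tensor linear_sum[OF linear_weight_op] linear_diff[OF linear_Lop]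
        euler_pvar_mult euler_pdiff tensor_bilin sum.distrib sum_subtractf scaleR_2 sum_distrib_left)
qed

lemma tens_swap_swap [simp]: "tens_swap (tens_swap t) = t"
  by (rule linear_eq_on_tensors[of "\<lambda>t. tens_swap (tens_swap t)" "\<lambda>t. t"])
     (auto intro!: tens_op_linear_comp tens_op_linear simp: tens_swap_tensor linear_id[unfolded id_def])

lemma tens_swap_Lambda_op: "tens_swap (Lambda_op t) = Lop (tens_swap t)"
  by (rule linear_eq_on_tensors[of "\<lambda>t. tens_swap (Lambda_op t)" "\<lambda>t. Lop (tens_swap t)"])
     (auto intro!: tens_op_linear_comp tens_op_linear simp: tens_op_tensor linear_sum[OF linear_tens_swap])

lemma tens_swap_weight_op: "tens_swap (weight_op t) = - weight_op (tens_swap t)"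
  by (rule linear_eq_on_tensors[of "\<lambda>t. tens_swap (weight_op t)" "\<lambda>t. - weight_op (tens_swap t)"])
     (auto intro!: tens_op_linear_comp tens_op_linear linear_compose_neg
       simp: tens_op_tensor linear_diff[OF linear_tens_swap])

lemma weight_op_Lambda_op:
  fixes t :: "'n::finite tens"
  shows "weight_op (Lambda_op t) = Lambda_op (weight_op t) - 2 *\<^sub>R Lambda_op t"
proof -
  have *: "Lambda_op u = tens_swap (Lop (tens_swap u))" for u :: "'n tens"
    using tens_swap_Lambda_op[of u] by (metis tens_swap_swap)
  have w: "weight_op (tens_swap u) = - tens_swap (weight_op u)" for u :: "'n tens"
    by (simp add: tens_swap_weight_op)
  show ?thesis
    by (simp add: * w weight_op_Lop linear_add[OF linear_tens_swap] linear_neg[OF linear_tens_swap]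
        linear_diff[OF linear_tens_swap] linear_neg[OF linear_Lop] linear_scale[OF linear_tens_swap])
qed

interpretation sl2: sl2_action Lop Lambda_op weight_op
  by (rule sl2_action.intro)
     (rule linear_Lop linear_Lambda_op linear_weight_op Lop_Lambda_op weight_op_Lop weight_op_Lambda_op)+

text \<open>
  Commutation with partial derivatives. The induction on bidegree in
  \<open>Lop_pow_lowest_weight\<close> runs on these rules.
\<close>

lemma diff_right_Lop: "diff_right k (Lop t) = Lop (diff_right k t)"
  by (rule linear_eq_on_tensors[of "\<lambda>t. diff_right k (Lop t)" "\<lambda>t. Lop (diff_right k t)"])
     (auto intro!: tens_op_linear_comp tens_op_linear
       simp: tens_op_tensor linear_sum[OF linear_diff_right] pdiff_commute)

lemma diff_left_Lambda_op: "diff_left k (Lambda_op t) = Lambda_op (diff_left k t)"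
  by (rule linear_eq_on_tensors[of "\<lambda>t. diff_left k (Lambda_op t)" "\<lambda>t. Lambda_op (diff_left k t)"])
     (auto intro!: tens_op_linear_comp tens_op_linear
       simp: tens_op_tensor linear_sum[OF linear_diff_left] pdiff_commute)

lemma diff_left_Lop: "diff_left k (Lop t) = Lop (diff_left k t) + diff_right k t"
proof (rule linear_eq_on_tensors[of "\<lambda>t. diff_left k (Lop t)" "\<lambda>t. Lop (diff_left k t) + diff_right k t"])
  show "linear (\<lambda>t. diff_left k (Lop t))" "linear (\<lambda>t. Lop (diff_left k t) + diff_right k t)"
    by (intro linear_compose_add tens_op_linear_comp tens_op_linear)+
  fix d f :: "'a rpoly"
  have "diff_left k (Lop (d \<otimes> f))
      = (\<Sum>j\<in>UNIV. (if j = k then d \<otimes> pdiff k f else 0) + (pvar j * pdiff k d) \<otimes> pdiff j f)"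
    unfolding Lop_tensor linear_sum[OF linear_diff_left]
    by (intro sum.cong refl) (auto simp: diff_left_tensor pdiff_pvar_mult tensor_bilin pdiff_commute)
  then show "diff_left k (Lop (d \<otimes> f)) = Lop (diff_left k (d \<otimes> f)) + diff_right k (d \<otimes> f)"
    by (simp add: sum.distrib tens_op_tensor)
qed

lemma tens_swap_diff_left: "tens_swap (diff_left k t) = diff_right k (tens_swap t)"
  by (rule linear_eq_on_tensors[of "\<lambda>t. tens_swap (diff_left k t)" "\<lambda>t. diff_right k (tens_swap t)"])
     (auto intro!: tens_op_linear_comp tens_op_linear simp: tens_op_tensor)

lemma tens_swap_diff_right: "tens_swap (diff_right k t) = diff_left k (tens_swap t)"
  by (metis tens_swap_swap tens_swap_diff_left)

lemma diff_right_Lambda_op: "diff_right k (Lambda_op t) = Lambda_op (diff_right k t) + diff_left k t"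
proof -
  have "tens_swap (diff_right k (Lambda_op t)) = tens_swap (Lambda_op (diff_right k t) + diff_left k t)"
    by (simp add: tens_swap_diff_right tens_swap_diff_left tens_swap_Lambda_op diff_left_Lop
        linear_add[OF linear_tens_swap])
  then show ?thesis by (metis tens_swap_swap)
qed

lemma diff_right_Lop_pow: "diff_right k ((Lop ^^ n) t) = (Lop ^^ n) (diff_right k t)"
  by (induction n) (simp_all add: diff_right_Lop)

lemma diff_left_Lop_pow:
  "diff_left k ((Lop ^^ Suc n) t) = (Lop ^^ Suc n) (diff_left k t) + real (Suc n) *\<^sub>R (Lop ^^ n) (diff_right k t)"
proof (induction n)
  case 0
  show ?case by (simp add: diff_left_Lop)
next
  case (Suc n)
  have "diff_left k ((Lop ^^ Suc (Suc n)) t)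
      = Lop (diff_left k ((Lop ^^ Suc n) t)) + (Lop ^^ Suc n) (diff_right k t)"
    unfolding funpow.simps(2)[of "Suc n"] comp_apply diff_left_Lop diff_right_Lop_pow ..
  moreover have "real (Suc (Suc n)) *\<^sub>R Lop u = real (Suc n) *\<^sub>R Lop u + Lop u" for u :: "'a tens"
    by (simp only: of_nat_Suc[of "Suc n"] scaleR_add_left scaleR_one add.commute)
  ultimately show ?case
    unfolding Suc by (simp only: linear_add[OF linear_Lop] linear_scale[OF linear_Lop]
        funpow.simps(2) comp_apply add.assoc)
qed


section \<open>The bigrading\<close>

text \<open>
  The piece of bidegree \<open>(p, q)\<close>. Its weight is \<open>p - q\<close>, and it is \<open>H\<^bsub>n,p+q\<^esub>\<^bsup>p-q\<^esup>\<close>; unlike the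
  grading by weight, this indexing lives in the natural numbers and so supports induction.
\<close>

definition bihomog :: "nat \<Rightarrow> nat \<Rightarrow> 'n::finite tens set" where
  "bihomog p q = span {d \<otimes> f | d f. d \<in> homog p \<and> f \<in> homog q}"

lemma subspace_bihomog: "subspace (bihomog p q)"
  by (simp add: bihomog_def)

lemma tensor_bihomog: "d \<in> homog p \<Longrightarrow> f \<in> homog q \<Longrightarrow> d \<otimes> f \<in> bihomog p q"
  unfolding bihomog_def by (rule span_base) blast

lemma linear_maps_bihomog_into:
  assumes "linear F" "subspace W" "\<And>d f. d \<in> homog p \<Longrightarrow> f \<in> homog q \<Longrightarrow> F (d \<otimes> f) \<in> W"
    and "t \<in> bihomog p q"
  shows "F t \<in> W"
proof -
  have "F ` bihomog p q = span (F ` {d \<otimes> f | d f. d \<in> homog p \<and> f \<in> homog q})"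
    unfolding bihomog_def by (rule linear_span_image[OF assms(1), symmetric])
  also have "\<dots> \<subseteq> W" by (rule span_minimal) (use assms(2,3) in auto)
  finally show ?thesis using assms(4) by blast
qed

lemma tens_swap_bihomog: "t \<in> bihomog p q \<Longrightarrow> tens_swap t \<in> bihomog q p"
  by (rule linear_maps_bihomog_into[OF linear_tens_swap subspace_bihomog])
     (auto simp: tens_swap_tensor tensor_bihomog)

lemma Lop_bihomog: "t \<in> bihomog p (Suc q) \<Longrightarrow> Lop t \<in> bihomog (Suc p) q"
  by (rule linear_maps_bihomog_into[OF linear_Lop subspace_bihomog])
     (auto simp: Lop_tensor intro!: subspace_sum[OF subspace_bihomog] tensor_bihomog pvar_mult_homog pdiff_homog)

lemma Lop_bihomog_0: "t \<in> bihomog p 0 \<Longrightarrow> Lop t = 0"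
  using linear_maps_bihomog_into[OF linear_Lop subspace_single_0, of p 0 t]
  by (auto simp: Lop_tensor pdiff_homog_0 tensor_bilin)

lemma Lop_pow_bihomog: "t \<in> bihomog p (n + q) \<Longrightarrow> (Lop ^^ n) t \<in> bihomog (n + p) q"
proof (induction n arbitrary: q)
  case (Suc n)
  then have "(Lop ^^ n) t \<in> bihomog (n + p) (Suc q)" by simp
  then show ?case by (simp add: Lop_bihomog)
qed simp

text \<open>
  Each \<open>\<Lambda>\<close> lowers the degree in \<open>d\<close>. Under the swap this is the statement that \<open>L\<close> kills
  everything of degree \<open>0\<close> in \<open>x\<close>.
\<close>

lemma Lambda_op_nilpotent:
  assumes "t \<in> bihomog p q"
  shows "(Lambda_op ^^ Suc p) t = 0"
proof -
  have 1: "tens_swap ((Lambda_op ^^ n) t) = (Lop ^^ n) (tens_swap t)" for n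
    by (induction n) (simp_all add: tens_swap_Lambda_op)
  have "(Lop ^^ p) (tens_swap t) \<in> bihomog (p + q) 0"
    using tens_swap_bihomog[OF assms] by (intro Lop_pow_bihomog) simp
  then have "(Lop ^^ Suc p) (tens_swap t) = 0" by (simp add: Lop_bihomog_0)
  then show ?thesis
    using 1[of "Suc p"] by (metis tens_swap_swap linear_0[OF linear_tens_swap])
qed

lemma diff_left_bihomog: "t \<in> bihomog (Suc p) q \<Longrightarrow> diff_left k t \<in> bihomog p q"
  by (rule linear_maps_bihomog_into[OF linear_diff_left subspace_bihomog])
     (auto simp: diff_left_tensor tensor_bihomog pdiff_homog)

lemma diff_left_bihomog_0: "t \<in> bihomog 0 q \<Longrightarrow> diff_left k t = 0"
  using linear_maps_bihomog_into[OF linear_diff_left[of k] subspace_single_0, of 0 q t]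
  by (auto simp: diff_left_tensor pdiff_homog_0 tensor_bilin)

lemma diff_right_bihomog: "t \<in> bihomog p (Suc q) \<Longrightarrow> diff_right k t \<in> bihomog p q"
  by (rule linear_maps_bihomog_into[OF linear_diff_right subspace_bihomog])
     (auto simp: diff_right_tensor tensor_bihomog pdiff_homog)

lemma weight_op_bihomog:
  assumes "t \<in> bihomog p q"
  shows "weight_op t = (real p - real q) *\<^sub>R t"
proof -
  have "weight_op t - (real p - real q) *\<^sub>R t \<in> {0}"
  proof (rule linear_maps_bihomog_into[OF _ subspace_single_0 _ assms])
    show "linear (\<lambda>t::'a tens. weight_op t - (real p - real q) *\<^sub>R t)"
      by (intro linear_compose_sub linear_weight_op linear_compose_scale_right linear_id[unfolded id_def])
  qed (simp add: weight_op_tensor euler_homog tensor_bilin scaleR_diff_left)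
  then show ?thesis by simp
qed

text \<open>
  Euler's formula: a form of positive degree in \<open>x\<close> is determined by its \<open>x\<close>-derivatives. The
  identities of the next section are verified by differentiating them.
\<close>

lemma bihomog_diff_right_eq_0:
  assumes "t \<in> bihomog p (Suc q)" "\<And>k. diff_right k t = 0"
  shows "t = 0"
proof -
  have "(\<Sum>k\<in>UNIV. mult_right k (diff_right k t)) - real (Suc q) *\<^sub>R t \<in> {0}"
  proof (rule linear_maps_bihomog_into[OF _ subspace_single_0 _ assms(1)])
    show "linear (\<lambda>t::'a tens. (\<Sum>k\<in>UNIV. mult_right k (diff_right k t)) - real (Suc q) *\<^sub>R t)"
      by (intro linear_compose_sub linear_sum_ops linear_compose_scale_right tens_op_linear_comp
          tens_op_linear linear_id[unfolded id_def])
    fix d f :: "'a rpoly" assume "f \<in> homog (Suc q)"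
    from euler_homog[OF this]
    show "(\<Sum>k\<in>UNIV. mult_right k (diff_right k (d \<otimes> f))) - real (Suc q) *\<^sub>R (d \<otimes> f) \<in> {0}"
      by (simp add: tens_op_tensor euler_def tensor_sum_right[symmetric] tensor_bilin)
  qed
  then show ?thesis by (simp add: assms(2) linear_0[OF linear_mult_right] del: of_nat_Suc)
qed


section \<open>The swap on lowest weight vectors\<close>

lemma tens_swap_bihomog_0_0:
  assumes "t \<in> bihomog 0 0"
  shows "tens_swap t = t"
proof -
  have const: "\<exists>c. p = c *\<^sub>R 1" if "p \<in> homog 0" for p :: "'a rpoly"
    using that
  proof (induction rule: homog_induct)
    case (monom a)
    then show ?case by (intro exI[of _ 1]) (simp add: mdeg_eq_0 rmonom_0)
  next
    case zero
    show ?case by (intro exI[of _ 0]) simp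
  next
    case (scale_add c p q)
    then show ?case by (metis scaleR_add_left scaleR_scaleR)
  qed
  have "tens_swap t - t \<in> {0}"
  proof (rule linear_maps_bihomog_into[OF _ subspace_single_0 _ assms])
    fix d f :: "'a rpoly" assume "d \<in> homog 0" "f \<in> homog 0"
    then obtain c c' where "d = c *\<^sub>R 1" "f = c' *\<^sub>R 1" using const by blast
    then show "tens_swap (d \<otimes> f) - d \<otimes> f \<in> {0}"
      by (simp add: tens_swap_tensor tensor_bilin linear_scale[OF linear_tens_swap])
  qed (intro linear_compose_sub linear_tens_swap linear_id[unfolded id_def])
  then show ?thesis by simp
qed

text \<open>
  Polarization: on polynomials in \<open>x\<close> alone, the coefficient of \<open>t\<^sup>r\<close> in \<open>F(x + td)\<close> is \<open>F(d)\<close>.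
  The two sides have equal \<open>d\<close>-derivatives by induction on \<open>r\<close>.
\<close>

lemma Lop_pow_left_degree_0:
  assumes "t \<in> bihomog 0 r"
  shows "(Lop ^^ r) t = fact r *\<^sub>R tens_swap t"
  using assms
proof (induction r arbitrary: t)
  case 0
  then show ?case by (simp add: tens_swap_bihomog_0_0)
next
  case (Suc r)
  define X where "X = (Lop ^^ Suc r) t - fact (Suc r) *\<^sub>R tens_swap t"
  have "X \<in> bihomog (Suc r) 0"
    unfolding X_def using Lop_pow_bihomog[of t 0 "Suc r" 0] tens_swap_bihomog[OF Suc.prems] Suc.prems
    by (intro subspace_diff subspace_scale subspace_bihomog) auto
  then have "tens_swap X \<in> bihomog 0 (Suc r)" by (rule tens_swap_bihomog)
  moreover have "diff_right k (tens_swap X) = 0" for k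
  proof -
    have "diff_left k X = real (Suc r) *\<^sub>R (Lop ^^ r) (diff_right k t) - fact (Suc r) *\<^sub>R tens_swap (diff_right k t)"
      unfolding X_def linear_diff[OF linear_diff_left] diff_left_Lop_pow linear_scale[OF linear_diff_left]
        diff_left_bihomog_0[OF Suc.prems] tens_swap_diff_right
      by (simp add: linear_0[OF linear_funpow[OF linear_Lop]] linear_0[OF linear_Lop])
    also have "\<dots> = 0"
      using Suc.IH[OF diff_right_bihomog[OF Suc.prems]] by simp
    finally show ?thesis
      by (simp add: tens_swap_diff_left[symmetric] linear_0[OF linear_tens_swap])
  qed
  ultimately have "tens_swap X = 0" by (rule bihomog_diff_right_eq_0)
  then have "X = 0" by (metis tens_swap_swap linear_0[OF linear_tens_swap])
  then show ?case by (simp add: X_def)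
qed

text \<open>
  By Euler's formula it is enough to compare \<open>x\<^sub>k\<close>-derivatives. Put \<open>E = \<partial>F/\<partial>d\<^sub>k\<close> and
  \<open>G = \<partial>F/\<partial>x\<^sub>k\<close>. The derivative of \<open>s F\<close> is \<open>s E\<close> and that of \<open>L\<^sup>r F\<close> is \<open>L\<^sup>r G\<close>. Now \<open>E\<close> is again a
  lowest weight vector, of bidegree \<open>(i - 1, i + r)\<close>, and differentiating \<open>\<Lambda> F = 0\<close> gives
  \<open>\<Lambda> G = -E\<close>. The commutator formula applied to \<open>L\<^bsup>r+1\<^esup> \<Lambda> G\<close> therefore turns \<open>L\<^bsup>r+1\<^esup> E\<close> into
  \<open>-(r + 1) L\<^sup>r G\<close>: this is where the sign alternates, and the induction hypothesis for \<open>E\<close> finishes.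

  The condition \<open>L\<^bsup>r+1\<^esup> F = 0\<close> passes to \<open>G\<close> because \<open>L\<close> commutes with \<open>\<partial>/\<partial>x\<^sub>k\<close>; there it removes the
  term \<open>\<Lambda> L\<^bsup>r+1\<^esup> G\<close> from the commutator formula.
\<close>

lemma Lop_pow_lowest_weight:
  assumes "t \<in> bihomog i (i + r)" "Lambda_op t = 0" "(Lop ^^ Suc r) t = 0"
  shows "(Lop ^^ r) t = ((- 1) ^ i * fact r) *\<^sub>R tens_swap t"
  using assms
proof (induction i arbitrary: r t)
  case 0
  then show ?case by (simp add: Lop_pow_left_degree_0)
next
  case (Suc i)
  define X where "X = (Lop ^^ r) t - ((- 1) ^ Suc i * fact r) *\<^sub>R tens_swap t"
  have "X \<in> bihomog (Suc (i + r)) (Suc i)"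
    unfolding X_def using Lop_pow_bihomog[of t "Suc i" r "Suc i"] tens_swap_bihomog[OF Suc.prems(1)] Suc.prems(1)
    by (intro subspace_diff subspace_scale subspace_bihomog) (auto simp: add.commute)
  moreover have "diff_right k X = 0" for k
  proof -
    define E where "E = diff_left k t"
    define G where "G = diff_right k t"
    have LG: "Lambda_op G = - E"
      using diff_right_Lambda_op[of k t] Suc.prems(2)
      by (simp add: E_def G_def linear_0[OF linear_diff_right] eq_neg_iff_add_eq_0)
    have "G \<in> bihomog (Suc i) (i + r)"
      using Suc.prems(1) diff_right_bihomog[of t "Suc i" "i + r" k] by (simp add: G_def)
    from weight_op_bihomog[OF this] have wG: "weight_op G = (1 - real r) *\<^sub>R G" by simp
    have Gr: "(Lop ^^ Suc r) G = 0"
      unfolding G_def diff_right_Lop_pow[symmetric] Suc.prems(3) by (rule linear_0[OF linear_diff_right])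
    have powE: "(Lop ^^ n) (Lambda_op G) = - (Lop ^^ n) E" for n
      unfolding LG by (rule linear_neg[OF linear_funpow[OF linear_Lop]])
    \<comment> \<open>\<open>G\<close> has weight \<open>1 - r\<close>, so the scalar in \<open>e_pow_f\<close> is \<open>(r + 1) (1 - r + r) = r + 1\<close>\<close>
    have LE: "(Lop ^^ Suc r) E = - real (Suc r) *\<^sub>R (Lop ^^ r) G"
      using sl2.e_pow_f[OF wG, of r]
      unfolding Gr powE linear_0[OF linear_Lambda_op] add_0_left diff_add_cancel mult_1_right scaleR_minus_left
      by (metis add.inverse_inverse)
    have "(Lop ^^ Suc r) E = ((- 1) ^ i * fact (Suc r)) *\<^sub>R tens_swap E"
    proof (rule Suc.IH)
      show "E \<in> bihomog i (i + Suc r)"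
        using Suc.prems(1) diff_left_bihomog[of t i "Suc i + r" k] by (simp add: E_def)
      show "Lambda_op E = 0"
        using Suc.prems(2) by (simp add: E_def diff_left_Lambda_op[symmetric] linear_0[OF linear_diff_left])
      have "(Lop ^^ Suc (Suc r)) E = Lop ((Lop ^^ Suc r) E)" by simp
      also have "\<dots> = - real (Suc r) *\<^sub>R (Lop ^^ Suc r) G"
        unfolding LE by (simp add: linear_scale[OF linear_Lop] linear_neg[OF linear_Lop])
      finally show "(Lop ^^ Suc (Suc r)) E = 0" unfolding Gr by simp
    qed
    with LE have "real (Suc r) *\<^sub>R (Lop ^^ r) G = real (Suc r) *\<^sub>R (((- 1) ^ Suc i * fact r) *\<^sub>R tens_swap E)"
      by (simp add: algebra_simps eq_neg_iff_add_eq_0 neg_eq_iff_add_eq_0)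
    then have "(Lop ^^ r) G = ((- 1) ^ Suc i * fact r) *\<^sub>R tens_swap E"
      unfolding scaleR_cancel_left by (metis of_nat_neq_0)
    then show ?thesis
      unfolding X_def linear_diff[OF linear_diff_right] diff_right_Lop_pow linear_scale[OF linear_diff_right]
        tens_swap_diff_left[symmetric] E_def[symmetric] G_def[symmetric] by simp
  qed
  ultimately have "X = 0" by (rule bihomog_diff_right_eq_0)
  then show ?case unfolding X_def right_minus_eq .
qed


section \<open>The pairing\<close>

definition mono_fact :: "'n::finite mono \<Rightarrow> real" where
  "mono_fact a = (\<Prod>k\<in>UNIV. fact (lookup a k))"

lemma mono_fact_pos: "mono_fact a > 0"
  unfolding mono_fact_def by (intro prod_pos) simp

lemma mono_fact_add_single:
  "mono_fact (Poly_Mapping.single k 1 + a) = real (Suc (lookup a k)) * mono_fact a"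
proof -
  have "mono_fact (Poly_Mapping.single k 1 + a)
      = (\<Prod>j\<in>UNIV. (if j = k then real (Suc (lookup a k)) else 1) * fact (lookup a j))"
    unfolding mono_fact_def by (intro prod.cong) (auto simp: lookup_add lookup_single)
  then show ?thesis by (simp add: prod.distrib mono_fact_def)
qed

lemma dpair_pvar_mult: "dpair (pvar k * d) f = dpair d (pdiff k f)"
  by (metis diff_op_mult diff_op_pvar dpair_def mult.commute)

lemma dpair_1_rmonom: "dpair 1 (rmonom b) = (if b = 0 then 1 else 0)"
proof -
  have "(\<Prod>k\<in>UNIV. (0::real) ^ lookup b k) = (if b = 0 then 1 else 0)"
    by (auto simp: poly_mapping_eq_iff fun_eq_iff prod_zero_iff)
  then show ?thesis by (simp add: dpair_def diff_op_1 peval_def rmonom_def)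
qed

lemma dpair_rmonom: "dpair (rmonom a) (rmonom b) = (if a = b then mono_fact a else 0)"
proof (induction "mdeg a" arbitrary: a b)
  case 0
  then have "a = 0" by (simp add: mdeg_eq_0[symmetric])
  then show ?case by (auto simp: rmonom_0 dpair_1_rmonom mono_fact_def)
next
  case (Suc n)
  then obtain k where k: "lookup a k \<noteq> 0"
    by (metis mdeg_eq_0 nat.distinct(1) poly_mapping_eqI lookup_zero)
  let ?e = "Poly_Mapping.single k (1::nat)"
  define a' where "a' = a - ?e"
  have a: "a = ?e + a'" using mono_split[OF k] by (simp add: a'_def)
  have "n = mdeg a'" using Suc.hyps(2) mdeg_minus_single[OF k] by (simp add: a'_def)
  note IH = Suc.hyps(1)[OF this]
  have "dpair (rmonom a) (rmonom b) = real (lookup b k) * dpair (rmonom a') (rmonom (b - ?e))"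
    by (simp only: a rmonom_mult[symmetric] pvar_def[symmetric] dpair_pvar_mult pdiff_rmonom
        bilinear_rmul[OF bilinear_dpair]) simp
  also have "\<dots> = (if a = b then mono_fact a else 0)"
  proof (cases "lookup b k = 0")
    case True
    then show ?thesis using k by auto
  next
    case False
    then have "b = ?e + (b - ?e)" using mono_split[OF False] by simp
    then have "a = b \<longleftrightarrow> a' = b - ?e" using a by (metis add_left_cancel)
    moreover have "mono_fact a = real (lookup a k) * mono_fact a'"
      using mono_fact_add_single[of k a'] a by (metis add.commute lookup_add lookup_single_eq plus_1_eq_Suc)
    ultimately show ?thesis unfolding IH by auto
  qed
  finally show ?case .
qed

lemma linear_lookup: "linear (\<lambda>t :: 'a \<Rightarrow>\<^sub>0 real. lookup t c)"
  by (intro linearI) (simp_all add: lookup_add)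

lemma linear_pairing_left: "linear (\<lambda>s. pairing s t)"
  by (rule bilinear_pairing[unfolded bilinear_def, THEN conjunct2, rule_format])

lemma linear_pairing_right: "linear (pairing s)"
  by (rule bilinear_pairing[unfolded bilinear_def, THEN conjunct1, rule_format])

text \<open>
  The matrix of the pairing in the monomial basis: \<open>d\<^sup>a \<otimes> x\<^sup>b\<close> pairs only with \<open>d\<^sup>b \<otimes> x\<^sup>a\<close>, with
  value \<open>a! b!\<close>.
\<close>

lemma pairing_eq_lin_ext:
  "pairing s t = lin_ext (\<lambda>(a, b). lookup t (b, a) * (mono_fact a * mono_fact b)) s"
proof (rule linear_eq_on_monomials[of "\<lambda>s. pairing s t"])
  show "linear (\<lambda>s. pairing s t)" by (rule linear_pairing_left)
  fix c :: "'a mono \<times> 'a mono"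
  obtain a b where c: "c = (a, b)" by (cases c)
  have "pairing (rmonom a \<otimes> rmonom b) t = lookup t (b, a) * (mono_fact a * mono_fact b)"
  proof (rule linear_eq_on_monomials[of "pairing (rmonom a \<otimes> rmonom b)"])
    show "linear (pairing (rmonom a \<otimes> rmonom b))" by (rule linear_pairing_right)
    show "linear (\<lambda>t. lookup t (b, a) * (mono_fact a * mono_fact b))"
      by (intro linearI) (simp_all add: lookup_add algebra_simps)
    fix c' :: "'a mono \<times> 'a mono"
    obtain a' b' where c': "c' = (a', b')" by (cases c')
    show "pairing (rmonom a \<otimes> rmonom b) (Poly_Mapping.single c' 1)
        = lookup (Poly_Mapping.single c' 1) (b, a) * (mono_fact a * mono_fact b)"
      unfolding c' tensor_rmonom[symmetric] pairing_tensor dpair_rmonom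
      by (simp add: tensor_rmonom lookup_single when_def)
  qed
  then show "pairing (Poly_Mapping.single c 1) t
      = lin_ext (\<lambda>(a, b). lookup t (b, a) * (mono_fact a * mono_fact b)) (Poly_Mapping.single c 1)"
    by (simp add: c tensor_rmonom)
qed (rule linear_lin_ext)

lemma lookup_tens_swap: "lookup (tens_swap t) (a, b) = lookup t (b, a)"
proof (rule linear_eq_on_tensors[of "\<lambda>t. lookup (tens_swap t) (a, b)" "\<lambda>t. lookup t (b, a)"])
  show "linear (\<lambda>t. lookup (tens_swap t) (a, b))"
    by (rule linear_compose[OF linear_tens_swap linear_lookup, unfolded o_def])
qed (simp_all add: linear_lookup tens_swap_tensor lookup_tensor mult.commute)

lemma pairing_swap_pos:
  assumes "t \<noteq> 0"
  shows "pairing t (tens_swap t) > 0"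
proof -
  have "pairing t (tens_swap t)
      = (\<Sum>c\<in>keys t. (lookup t c)\<^sup>2 * (mono_fact (fst c) * mono_fact (snd c)))"
    unfolding pairing_eq_lin_ext lin_ext_def
    by (intro sum.cong) (auto simp: lookup_tens_swap power2_eq_square)
  also have "\<dots> > 0"
    using assms by (intro sum_pos) (auto simp: in_keys_iff mono_fact_pos)
  finally show ?thesis .
qed

lemma bilinear_eq_on_tensors:
  fixes s t :: "'n::finite tens" and F G :: "'n tens \<Rightarrow> 'n tens \<Rightarrow> real"
  assumes "bilinear F" "bilinear G"
    and "\<And>d f d' f'. F (d \<otimes> f) (d' \<otimes> f') = G (d \<otimes> f) (d' \<otimes> f')"
  shows "F s t = G s t"
proof -
  note lin = assms(1,2)[unfolded bilinear_def]
  have "F (d \<otimes> f) t = G (d \<otimes> f) t" for d f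
    by (rule linear_eq_on_tensors) (use lin assms(3) in blast)+
  then show ?thesis
    by (rule linear_eq_on_tensors[rotated 2]) (use lin in blast)+
qed

lemma bilinear_pairing_compose:
  assumes "linear A" "linear B"
  shows "bilinear (\<lambda>s t. pairing (A s) (B t))"
  using linear_compose[OF assms(1) linear_pairing_left] linear_compose[OF assms(2) linear_pairing_right]
  by (simp add: bilinear_def o_def)

lemma pairing_commute: "pairing s t = pairing t s"
proof (rule bilinear_eq_on_tensors[OF bilinear_pairing])
  show "bilinear (\<lambda>s t. pairing t s)"
    by (simp add: bilinear_def linear_pairing_left linear_pairing_right)
qed (simp add: pairing_tensor)

text \<open>
  Multiplication by \<open>d\<^sub>k\<close> is adjoint to \<open>\<partial>/\<partial>x\<^sub>k\<close> for the pairing of \<open>D\<close> with \<open>R\<close>, and \<open>L\<close> contains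
  one of each.
\<close>

lemma pairing_Lop: "pairing (Lop s) t = pairing s (Lop t)"
proof (rule bilinear_eq_on_tensors[of "\<lambda>s t. pairing (Lop s) t" "\<lambda>s t. pairing s (Lop t)"])
  show "bilinear (\<lambda>s t. pairing (Lop s) t)" "bilinear (\<lambda>s t. pairing s (Lop t))"
    using bilinear_pairing_compose[OF linear_Lop linear_id]
      bilinear_pairing_compose[OF linear_id linear_Lop] by simp_all
  fix d f d' f' :: "'a rpoly"
  show "pairing (Lop (d \<otimes> f)) (d' \<otimes> f') = pairing (d \<otimes> f) (Lop (d' \<otimes> f'))"
    by (simp add: Lop_tensor linear_sum[OF linear_pairing_left] linear_sum[OF linear_pairing_right] pairing_tensor dpair_pvar_mult)
qed

lemma pairing_Lop_pow: "pairing ((Lop ^^ r) s) t = pairing s ((Lop ^^ r) t)"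
  by (induction r arbitrary: t) (simp_all add: pairing_Lop funpow_swap1[symmetric])


section \<open>Equivariance\<close>

definition permute_mono :: "('n \<Rightarrow> 'n) \<Rightarrow> 'n::finite mono \<Rightarrow> 'n mono" where
  "permute_mono \<sigma> a = (\<Sum>k\<in>UNIV. Poly_Mapping.single (\<sigma> k) (lookup a k))"

lemma lookup_permute_mono:
  assumes "bij \<sigma>"
  shows "lookup (permute_mono \<sigma> a) (\<sigma> k) = lookup a k"
proof -
  have "lookup (permute_mono \<sigma> a) (\<sigma> k) = (\<Sum>j\<in>UNIV. if j = k then lookup a j else 0)"
    unfolding permute_mono_def lookup_sum
    using bij_is_inj[OF assms] by (intro sum.cong) (auto simp: lookup_single when_def inj_eq)
  then show ?thesis by simp
qed

lemma mono_eqI_along_bij: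
  assumes "bij \<sigma>" "\<And>k. lookup a (\<sigma> k) = lookup b (\<sigma> k)"
  shows "a = b"
  using assms by (metis bij_pointE poly_mapping_eqI)

lemma permute_mono_eq_iff:
  assumes "bij \<sigma>"
  shows "permute_mono \<sigma> a = permute_mono \<sigma> b \<longleftrightarrow> a = b"
  by (metis assms lookup_permute_mono poly_mapping_eqI)

lemma mono_fact_permute:
  assumes "bij \<sigma>"
  shows "mono_fact (permute_mono \<sigma> a) = mono_fact a"
proof -
  have "(\<Prod>k\<in>UNIV. fact (lookup (permute_mono \<sigma> a) (\<sigma> k)) :: real)
      = (\<Prod>k\<in>UNIV. fact (lookup (permute_mono \<sigma> a) k))"
    by (rule prod.reindex_bij_betw[OF assms])
  then show ?thesis by (simp add: mono_fact_def lookup_permute_mono[OF assms])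
qed

lemma dpair_permute:
  assumes "bij \<sigma>"
  shows "dpair (permute_vars \<sigma> d) (permute_vars \<sigma> f) = dpair d f"
proof (rule bilinear_eq_on_monomials[of "\<lambda>d f. dpair (permute_vars \<sigma> d) (permute_vars \<sigma> f)" dpair])
  show "bilinear (\<lambda>d f. dpair (permute_vars \<sigma> d) (permute_vars \<sigma> f))"
    using linear_compose[OF linear_permute_vars[of \<sigma>] bilinear_dpair[unfolded bilinear_def, THEN conjunct1, rule_format]]
      linear_compose[OF linear_permute_vars[of \<sigma>] bilinear_dpair[unfolded bilinear_def, THEN conjunct2, rule_format]]
    by (simp add: bilinear_def o_def)
  show "dpair (permute_vars \<sigma> (rmonom a)) (permute_vars \<sigma> (rmonom b)) = dpair (rmonom a) (rmonom b)" for a b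
    by (simp add: permute_vars_rmonom permute_mono_def[symmetric] dpair_rmonom
        permute_mono_eq_iff[OF assms] mono_fact_permute[OF assms])
qed (rule bilinear_dpair)

lemma pdiff_permute:
  assumes "bij \<sigma>"
  shows "pdiff (\<sigma> k) (permute_vars \<sigma> p) = permute_vars \<sigma> (pdiff k p)"
proof (rule linear_eq_on_monomials[of "\<lambda>p. pdiff (\<sigma> k) (permute_vars \<sigma> p)"
      "\<lambda>p. permute_vars \<sigma> (pdiff k p)", OF _ _ , folded rmonom_def])
  show "linear (\<lambda>p. pdiff (\<sigma> k) (permute_vars \<sigma> p))" "linear (\<lambda>p. permute_vars \<sigma> (pdiff k p))"
    using linear_compose[OF linear_permute_vars linear_pdiff] linear_compose[OF linear_pdiff linear_permute_vars]
    by (simp_all add: o_def)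
  fix a :: "'a mono"
  have "permute_mono \<sigma> a - Poly_Mapping.single (\<sigma> k) 1 = permute_mono \<sigma> (a - Poly_Mapping.single k (1::nat))"
    using bij_is_inj[OF assms]
    by (intro mono_eqI_along_bij[OF assms])
       (auto simp: lookup_minus lookup_permute_mono[OF assms] lookup_single when_def inj_eq)
  then show "pdiff (\<sigma> k) (permute_vars \<sigma> (rmonom a)) = permute_vars \<sigma> (pdiff k (rmonom a))"
    by (simp add: permute_vars_rmonom permute_mono_def[symmetric] pdiff_rmonom
        lookup_permute_mono[OF assms] linear_scale[OF linear_permute_vars])
qed

lemma pairing_tens_act:
  assumes "bij \<sigma>"
  shows "pairing (tens_act \<sigma> s) (tens_act \<sigma> t) = pairing s t"
proof (rule bilinear_eq_on_tensors[of "\<lambda>s t. pairing (tens_act \<sigma> s) (tens_act \<sigma> t)" pairing])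
  show "bilinear (\<lambda>s t. pairing (tens_act \<sigma> s) (tens_act \<sigma> t))"
    by (intro bilinear_pairing_compose linear_tens_act)
qed (simp_all add: bilinear_pairing tens_act_tensor pairing_tensor dpair_permute[OF assms])

lemma Lop_tens_act:
  assumes "bij \<sigma>"
  shows "Lop (tens_act \<sigma> t) = tens_act \<sigma> (Lop t)"
proof (rule linear_eq_on_tensors[of "\<lambda>t. Lop (tens_act \<sigma> t)" "\<lambda>t. tens_act \<sigma> (Lop t)"])
  show "linear (\<lambda>t. Lop (tens_act \<sigma> t))" "linear (\<lambda>t. tens_act \<sigma> (Lop t))"
    using linear_compose[OF linear_tens_act linear_Lop] linear_compose[OF linear_Lop linear_tens_act]
    by (simp_all add: o_def)
  fix d f :: "'a rpoly"
  let ?g = "\<lambda>k. (pvar k * permute_vars \<sigma> d) \<otimes> pdiff k (permute_vars \<sigma> f)"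
  have "(\<Sum>k\<in>UNIV. ?g (\<sigma> k)) = (\<Sum>k\<in>UNIV. ?g k)"
    by (rule sum.reindex_bij_betw[OF assms])
  then show "Lop (tens_act \<sigma> (d \<otimes> f)) = tens_act \<sigma> (Lop (d \<otimes> f))"
    by (simp add: Lop_tensor tens_act_tensor linear_sum[OF linear_tens_act] permute_vars_mult
        permute_vars_pvar pdiff_permute[OF assms])
qed

lemma Lop_pow_tens_act:
  assumes "bij \<sigma>"
  shows "(Lop ^^ r) (tens_act \<sigma> t) = tens_act \<sigma> ((Lop ^^ r) t)"
  by (induction r) (simp_all add: Lop_tens_act[OF assms])


section \<open>The graded pieces\<close>

lemma H_piece_bihomog:
  assumes "p + q = m" "j = int p - int q"
  shows "H_piece m j = (bihomog p q :: 'n::finite tens set)"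
proof -
  have "i = p \<and> m - i = q" if "i \<le> m" "j = - int m + 2 * int i" for i
    using that assms by auto
  moreover have "p \<le> m" "j = - int m + 2 * int p" "m - p = q"
    using assms by auto
  ultimately have "{d \<otimes> f | d f i. i \<le> m \<and> j = - int m + 2 * int i \<and> d \<in> homog i \<and> f \<in> homog (m - i)}
      = {d \<otimes> f | d f. d \<in> homog p \<and> (f :: 'n rpoly) \<in> homog q}"
    by blast
  then show ?thesis by (simp only: H_piece_def bihomog_def)
qed

lemma H_piece_trivial:
  assumes "\<And>p q. p + q = m \<Longrightarrow> j \<noteq> int p - int q"
  shows "H_piece m j = ({0} :: 'n::finite tens set)"
proof -
  have "j \<noteq> - int m + 2 * int i" if "i \<le> m" for i
    using assms[of i "m - i"] that by (simp add: of_nat_diff)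
  then have "{d \<otimes> f | d f i. i \<le> m \<and> j = - int m + 2 * int i \<and> d \<in> homog i \<and> (f :: 'n rpoly) \<in> homog (m - i)} = {}"
    by blast
  then show ?thesis by (simp only: H_piece_def span_empty)
qed

lemma degree_cases:
  obtains (bihomog) p q where "p + q = m" "j = int p - int q"
  | (trivial) "\<And>p q. p + q = m \<Longrightarrow> j \<noteq> int p - int q"
  by blast

lemma Lop_H_piece: "Lop ` H_piece m j \<subseteq> H_piece m (j + 2)"
proof clarify
  fix t :: "'a tens" assume t: "t \<in> H_piece m j"
  have 0: "0 \<in> H_piece m (j + 2)" unfolding H_piece_def by (rule span_zero)
  show "Lop t \<in> H_piece m (j + 2)"
  proof (cases rule: degree_cases[of m j])
    case (bihomog p q)
    with t have tp: "t \<in> bihomog p q" by (simp add: H_piece_bihomog)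
    show ?thesis
    proof (cases q)
      case 0
      then show ?thesis using tp \<open>0 \<in> _\<close> by (simp add: Lop_bihomog_0)
    next
      case (Suc q')
      then have "H_piece m (j + 2) = (bihomog (Suc p) q' :: 'a tens set)"
        using bihomog by (intro H_piece_bihomog) auto
      then show ?thesis using Lop_bihomog tp Suc by blast
    qed
  next
    case trivial
    then have "t = 0" using t H_piece_trivial by blast
    then show ?thesis using 0 by (simp add: linear_0[OF linear_Lop])
  qed
qed

lemma tens_swap_H_piece:
  fixes t :: "'n::finite tens"
  assumes "t \<in> H_piece m j"
  shows "tens_swap t \<in> H_piece m (- j)"
proof (cases rule: degree_cases[of m j])
  case (bihomog p q)
  then have "tens_swap t \<in> bihomog q p" using assms by (simp add: H_piece_bihomog tens_swap_bihomog)
  moreover have "H_piece m (- j) = (bihomog q p :: 'n tens set)"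
    using bihomog by (intro H_piece_bihomog) auto
  ultimately show ?thesis by simp
next
  case trivial
  then have "t = 0" using assms H_piece_trivial by blast
  then show ?thesis unfolding H_piece_def by (simp add: linear_0[OF linear_tens_swap] span_zero)
qed

lemma finite_monos_of_degree: "finite {a :: 'n::finite mono. mdeg a = i}"
proof (rule finite_imageD)
  have "lookup a k \<le> i" if "mdeg a = i" for a :: "'n mono" and k
    using that member_le_sum[of k UNIV "lookup a"] by (simp add: mdeg_def)
  then have "lookup ` {a :: 'n mono. mdeg a = i} \<subseteq> PiE UNIV (\<lambda>_. {..i})" by auto
  then show "finite (lookup ` {a :: 'n mono. mdeg a = i})"
    by (rule finite_subset) (intro finite_PiE finite finite_atMost)
  show "inj_on lookup {a :: 'n mono. mdeg a = i}"
    by (rule inj_onI) (simp only: lookup_inject)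
qed

lemma bihomog_finite_span:
  obtains T where "finite T" "bihomog p q = span T"
proof
  let ?T = "(\<lambda>(a, b). rmonom a \<otimes> rmonom b) ` ({a. mdeg a = p} \<times> {b. mdeg b = q})"
  show "finite ?T" by (intro finite_imageI finite_cartesian_product finite_monos_of_degree)
  show "bihomog p q = span ?T"
  proof
    have "d \<otimes> f \<in> span ?T" if d: "d \<in> homog p" and f: "f \<in> homog q" for d f
    proof -
      have 1: "rmonom a \<otimes> f \<in> span ?T" if a: "mdeg a = p" for a
        using f
      proof (induction rule: homog_induct)
        case (monom b)
        then show ?case using a by (intro span_base) auto
      qed (simp_all add: tensor_bilin span_zero span_add span_scale)
      from d show ?thesis
        by (induction rule: homog_induct) (simp_all add: 1 tensor_bilin span_zero span_add span_scale)
    qed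
    then show "bihomog p q \<subseteq> span ?T"
      unfolding bihomog_def by (intro span_minimal) auto
    show "span ?T \<subseteq> bihomog p q"
      by (intro span_minimal subspace_bihomog) (auto intro: tensor_bihomog rmonom_homog)
  qed
qed

text \<open>
  Followed by the swap, \<open>L\<^sup>r\<close> becomes an injective endomorphism of a finite-dimensional space, hence
  surjective.
\<close>

lemma Lop_pow_bij_betw_bihomog:
  "bij_betw (Lop ^^ r) (bihomog p (r + p) :: 'n::finite tens set) (bihomog (r + p) p)"
proof -
  let ?g = "\<lambda>t :: 'n tens. tens_swap ((Lop ^^ r) t)"
  have lin: "linear (Lop ^^ r :: 'n tens \<Rightarrow> 'n tens)" by (rule linear_funpow[OF linear_Lop])
  have ker: "t = 0" if t: "t \<in> bihomog p (r + p)" and 0: "(Lop ^^ r) t = 0" for t :: "'n tens"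
    using sl2.e_pow_inj[OF Lambda_op_nilpotent[OF t] _ 0 order_refl] weight_op_bihomog[OF t] by simp
  have into: "?g ` bihomog p (r + p) \<subseteq> bihomog p (r + p)"
    using Lop_pow_bihomog tens_swap_bihomog by blast
  have surj: "?g ` bihomog p (r + p) = bihomog p (r + p)"
  proof (rule bihomog_finite_span[of p "r + p"])
    fix T :: "'n tens set" assume T: "finite T" "bihomog p (r + p) = span T"
    show ?thesis
      unfolding T(2)
    proof (rule injective_endo_of_finite_span_surj[OF _ T(1) into[unfolded T(2)]])
      show "linear ?g" using linear_compose[OF lin linear_tens_swap] by (simp add: o_def)
      fix t assume "t \<in> span T" and 0: "?g t = 0"
      then have "(Lop ^^ r) t = 0" by (metis tens_swap_swap linear_0[OF linear_tens_swap])
      then show "t = 0" using ker \<open>t \<in> span T\<close> T(2) by blast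
    qed
  qed
  have "inj_on (Lop ^^ r) (bihomog p (r + p) :: 'n tens set)"
    using ker linear_inj_on_iff_eq_0[OF lin subspace_bihomog] by blast
  moreover have "(Lop ^^ r) ` bihomog p (r + p) = (bihomog (r + p) p :: 'n tens set)"
  proof
    show "bihomog (r + p) p \<subseteq> (Lop ^^ r) ` (bihomog p (r + p) :: 'n tens set)"
    proof
      fix u :: "'n tens" assume "u \<in> bihomog (r + p) p"
      then have "tens_swap u \<in> ?g ` bihomog p (r + p)" unfolding surj by (rule tens_swap_bihomog)
      then show "u \<in> (Lop ^^ r) ` bihomog p (r + p)" by (metis (no_types, lifting) imageE imageI tens_swap_swap)
    qed
  qed (use Lop_pow_bihomog in blast)
  ultimately show ?thesis by (simp add: bij_betw_def)
qed

lemma hard_lefschetz_H_piece: "hard_lefschetz (H_piece m) (Lop :: 'n::finite tens \<Rightarrow> 'n tens)"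
  unfolding hard_lefschetz_def
proof
  fix i :: nat
  show "bij_betw (Lop ^^ i) (H_piece m (- int i) :: 'n tens set) (H_piece m (int i))"
  proof (cases rule: degree_cases[of m "int i"])
    case (bihomog p q)
    then have "H_piece m (- int i) = (bihomog q (i + q) :: 'n tens set)"
      "H_piece m (int i) = (bihomog (i + q) q :: 'n tens set)"
      by (auto intro!: H_piece_bihomog)
    then show ?thesis using Lop_pow_bij_betw_bihomog by simp
  next
    case trivial
    then have "H_piece m (int i) = ({0} :: 'n tens set)" by (rule H_piece_trivial)
    moreover have "H_piece m (- int i) = ({0} :: 'n tens set)"
    proof (rule H_piece_trivial)
      fix p q assume "p + q = m"
      then show "- int i \<noteq> int p - int q" using trivial[of q p] by auto
    qed
    ultimately show ?thesis
      by (simp add: bij_betw_def linear_0[OF linear_funpow[OF linear_Lop]])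
  qed
qed

lemma graded_pairing: "graded_form (H_piece m) (pairing :: 'n::finite tens \<Rightarrow> 'n tens \<Rightarrow> real)"
  unfolding graded_form_def
proof (intro allI impI ballI)
  fix i j :: int and s t :: "'n tens"
  assume ij: "i \<noteq> - j" and s: "s \<in> H_piece m i" and t: "t \<in> H_piece m j"
  show "pairing s t = 0"
    unfolding pairing_eq_lin_ext lin_ext_def
  proof (rule sum.neutral, clarify)
    fix a b assume ab: "(a, b) \<in> keys s"
    have "lookup t (b, a) = 0"
    proof (rule ccontr)
      assume "lookup t (b, a) \<noteq> 0"
      then have "(b, a) \<in> keys t" by (simp add: in_keys_iff)
      then show False using s t ab ij by (fastforce simp: H_piece_iff)
    qed
    then show "lookup s (a, b) *\<^sub>R (lookup t (b, a) * (mono_fact a * mono_fact b)) = 0" by simp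
  qed
qed

lemma nondegenerate_pairing:
  "nondegenerate_on (gr_total (H_piece m)) (pairing :: 'n::finite tens \<Rightarrow> 'n tens \<Rightarrow> real)"
proof -
  \<comment> \<open>\<open>s t\<close> is the witness that \<open>t\<close> is not in the radical, so it must stay in the total space\<close>
  have sw: "tens_swap t \<in> gr_total (H_piece m)" if "t \<in> gr_total (H_piece m)" for t :: "'n tens"
  proof -
    have "tens_swap ` gr_total (H_piece m) = span (tens_swap ` (\<Union>j. H_piece m j :: 'n tens set))"
      unfolding gr_total_def by (rule linear_span_image[OF linear_tens_swap, symmetric])
    also have "\<dots> \<subseteq> gr_total (H_piece m)"
      unfolding gr_total_def using tens_swap_H_piece by (intro span_mono) blast
    finally show ?thesis using that by blast
  qed
  have "t = 0" if t: "t \<in> gr_total (H_piece m)"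
    and *: "\<And>u. u \<in> gr_total (H_piece m) \<Longrightarrow> pairing t u = 0" for t :: "'n tens"
    using pairing_swap_pos[of t] *[OF sw[OF t]] by force
  then show ?thesis
    unfolding nondegenerate_on_def by (metis pairing_commute)
qed

lemma hodge_riemann_H_piece:
  assumes "2 * i \<le> m"
  shows "pos_definite_on (primitive (H_piece m) Lop (m - 2 * i))
    (\<lambda>a b :: 'n::finite tens. (- 1) ^ i * lefschetz_form pairing Lop (m - 2 * i) a b)"
  unfolding pos_definite_on_def
proof (intro ballI impI)
  fix t :: "'n tens"
  define r where "r = m - 2 * i"
  assume t: "t \<in> primitive (H_piece m) Lop (m - 2 * i)" and "t \<noteq> 0"
  have "H_piece m (- int r) = (bihomog i (i + r) :: 'n tens set)"
    using assms by (intro H_piece_bihomog) (auto simp: r_def)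
  then have tb: "t \<in> bihomog i (i + r)" and Lt: "(Lop ^^ Suc r) t = 0"
    using t by (auto simp: primitive_def r_def)
  have "Lambda_op t = 0"
    using sl2.primitive_lowest_weight[OF Lambda_op_nilpotent[OF tb] _ Lt] weight_op_bihomog[OF tb] by simp
  from Lop_pow_lowest_weight[OF tb this Lt]
  have "(- 1) ^ i * pairing t ((Lop ^^ r) t) = fact r * pairing t (tens_swap t)"
    by (simp add: bilinear_rmul[OF bilinear_pairing] mult.assoc[symmetric] power_mult_distrib[symmetric])
  then show "0 < (- 1) ^ i * lefschetz_form pairing Lop (m - 2 * i) t t"
    using pairing_swap_pos[OF \<open>t \<noteq> 0\<close>] by (simp add: lefschetz_form_def r_def[symmetric])
qed

theorem theorem7:
  fixes m :: nat and V :: "int \<Rightarrow> 'n::finite tens set"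
  assumes "V = H_piece m"
  shows
    "(bilinear (pairing :: 'n tens \<Rightarrow> 'n tens \<Rightarrow> real) \<and>
      equivariant_form_on tens_act (gr_total V) pairing \<and>
      symmetric_form_on (gr_total V) pairing \<and>
      graded_form V pairing \<and>
      nondegenerate_on (gr_total V) pairing)
   \<and>
     (equivariant_op_on tens_act (gr_total V) Lop \<and>
      lefschetz_operator V pairing Lop \<and>
      hard_lefschetz V Lop)
   \<and>
     (\<forall>i::nat. 2 * i \<le> m \<longrightarrow>
        (let W = V (- int m + 2 * int i);
             form = lefschetz_form pairing Lop (m - 2 * i)
         in bilinear form \<and>
            symmetric_form_on W form \<and>
            equivariant_form_on tens_act W form \<and>
            pos_definite_on (primitive V Lop (m - 2 * i)) (\<lambda>a b. (- 1) ^ i * form a b)))"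
proof -
  have form: "bilinear (lefschetz_form pairing Lop r :: 'n tens \<Rightarrow> 'n tens \<Rightarrow> real)"
    "symmetric_form_on W (lefschetz_form pairing Lop r :: 'n tens \<Rightarrow> 'n tens \<Rightarrow> real)"
    "equivariant_form_on tens_act W (lefschetz_form pairing Lop r :: 'n tens \<Rightarrow> 'n tens \<Rightarrow> real)"
    for r and W :: "'n tens set"
  proof -
    show "bilinear (lefschetz_form pairing Lop r :: 'n tens \<Rightarrow> 'n tens \<Rightarrow> real)"
      using bilinear_pairing_compose[OF linear_id linear_funpow[OF linear_Lop], of r]
      by (simp add: lefschetz_form_def[abs_def])
    show "symmetric_form_on W (lefschetz_form pairing Lop r)"
      by (metis (no_types, lifting) lefschetz_form_def pairing_Lop_pow pairing_commute symmetric_form_on_def)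
    show "equivariant_form_on tens_act W (lefschetz_form pairing Lop r)"
      by (simp add: equivariant_form_on_def lefschetz_form_def Lop_pow_tens_act pairing_tens_act)
  qed
  have "equivariant_form_on tens_act (gr_total V) pairing"
    by (simp add: equivariant_form_on_def pairing_tens_act)
  moreover have "symmetric_form_on (gr_total V) pairing"
    by (simp add: symmetric_form_on_def pairing_commute)
  moreover have "equivariant_op_on tens_act (gr_total V) Lop"
    by (simp add: equivariant_op_on_def Lop_tens_act)
  moreover have "lefschetz_operator V pairing Lop"
    unfolding lefschetz_operator_def assms using Lop_H_piece by (auto simp: linear_Lop pairing_Lop)
  ultimately show ?thesis
    unfolding Let_def assms
    using form bilinear_pairing graded_pairing nondegenerate_pairing hard_lefschetz_H_piece
      hodge_riemann_H_piece by blast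
qed

end
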